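(* Let $R$ and $R'$ be sufficiently disconnected topological rings, each together with a good topologization of its points on finite-type schemes over it with the smooth quotient property. Let $R\to R'$ be a continuous ring homomorphism, and assume furthermore that $X(R)\to X(R')=X_{R'}(R')$ is continuous for all finite-type $R$-schemes $X$. Then for each algebraic stack $\mathfrak{X}$ over $R$, the natural map $\mathfrak{X}(R)\to\mathfrak{X}_{R'}(R')$ is continuous, where $\mathfrak{X}_{R'}=\mathfrak{X}\times_{\operatorname{Spec}R}\operatorname{Spec}R'$.
   Context: All topological rings are Hausdorff; all schemes, algebraic spaces and algebraic stacks over a ring are of finite type over it. For an algebraic stack $\mathfrak{X}$ over $R$, $\mathfrak{X}(R)$ is the set of isomorphism classes of $R$-points. A smooth cover is a smooth surjective morphism. A ring $R$ is sufficiently disconnected if (1) every finitely generated projective $R$-module is free; and (2) for every faithfully flat étale $R\to R'$ there exists an $R'$-algebra $R''$ such that $R\to R''$ is finite étale and faithfully flat. A good topologization of $R$-points of finite-type $R$-schemes is a choice of a topology on $X(R)$ for every finite-type $R$-scheme $X$ such that: (1) $\mathbb{A}^1_R(R)=R$ as topological spaces; (2) every morphism $X\to Y$ of finite-type $R$-schemes induces a continuous map $X(R)\to Y(R)$; (3) for a closed immersion $Y\hookrightarrow X$, $Y(R)\subseteq X(R)$ is a closed subset with the subspace topology; (4) $(X\times_R Y)(R)=X(R)\times Y(R)$ with the product topology. It has the smooth quotient property if for every smooth morphism $X\to Y$ of finite-type $R$-schemes with $X(R)\to Y(R)$ surjective, the map $X(R)\to Y(R)$ is a topological quotient map. Topology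 on $\mathfrak{X}(R)$: for each smooth cover $Z\to\mathfrak{X}$ by an $R$-scheme $Z$, let $\mathfrak{X}(R)_Z$ be the image of $Z(R)$ in $\mathfrak{X}(R)$ with the quotient topology from $Z(R)$. Then $\mathfrak{X}(R)$ has the topology of $\operatorname{colim}_Z\mathfrak{X}(R)_Z$ over the category of such covers (with morphisms the smooth maps $Z_1\to Z_2$ over $\mathfrak{X}$); that is, $W\subseteq\mathfrak{X}(R)$ is open iff its preimage in $Z(R)$ is open for every smooth cover $Z\to\mathfrak{X}$ by a scheme. The same definition over $R'$ gives the topology on $\mathfrak{X}_{R'}(R')$. *)

theory Defs
  imports
    "HOL-Algebra.QuotRing"
    "HOL-Algebra.Module"
    "HOL-Algebra.Generated_Rings"
    "HOL-Analysis.Analysis"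
begin

text \<open>
  Schemes, algebraic spaces and algebraic stacks are given by their functors of points on
  commutative algebras.

  Universe: all test rings have their carrier in one type \<open>'u\<close>. If \<open>'u\<close> is infinite, the rings
  with carrier in \<open>'u\<close> are, up to isomorphism, exactly the rings of cardinality at most that of
  \<open>'u\<close>. They are closed under finitely generated algebras, localizations, tensor products and
  residue fields, so that every notion below (including those given by a universal property)
  has its usual meaning. A finite type scheme over such a ring has at most \<open>'u\<close> many points in
  each test ring, so up to isomorphism it is a functor with values in subsets of \<open>'u\<close>. The
  objects and morphisms of a stack live in arbitrary types.
\<close>


section \<open>Algebras over a ring\<close>

text \<open>An \<open>R\<close>-algebra is a pair of a ring and a structure map. Ring homomorphisms
  are taken extensional, so that equality of functions is equality of homomorphisms. An algebra
  \<open>b \<in> algs A\<close> also stands for the affine scheme \<open>Spec b \<rightarrow> Spec A\<close>.\<close>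

type_synonym 'u alg = "'u ring \<times> ('u \<Rightarrow> 'u)"

definition algs :: "'u ring \<Rightarrow> 'u alg set" where
  "algs R = {(A, \<phi>). cring A \<and> \<phi> \<in> ring_hom R A \<and> \<phi> \<in> extensional (carrier R)}"

definition alg_hom :: "'u ring \<Rightarrow> 'u alg \<Rightarrow> 'u alg \<Rightarrow> ('u \<Rightarrow> 'u) set" where
  "alg_hom R a b = {h \<in> ring_hom (fst a) (fst b).
      h \<in> extensional (carrier (fst a)) \<and> compose (carrier R) h (snd a) = snd b}"

definition id_hom :: "'u ring \<Rightarrow> 'u \<Rightarrow> 'u" where
  "id_hom A = (\<lambda>x\<in>carrier A. x)"

definition self_alg :: "'u ring \<Rightarrow> 'u alg" where
  "self_alg R = (R, id_hom R)"

text \<open>Restriction of scalars of an algebra along a ring homomorphism \<open>\<phi>\<close> with source \<open>R\<close>.\<close>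

definition restr :: "'u ring \<Rightarrow> ('u \<Rightarrow> 'u) \<Rightarrow> 'u alg \<Rightarrow> 'u alg" where
  "restr R \<phi> b = (fst b, compose (carrier R) (snd b) \<phi>)"

definition finite_type_alg :: "'u ring \<Rightarrow> 'u alg \<Rightarrow> bool" where
  "finite_type_alg A b \<longleftrightarrow> (\<exists>S. finite S \<and> S \<subseteq> carrier (fst b) \<and>
      generate_ring (fst b) (snd b ` carrier A \<union> S) = carrier (fst b))"

definition finite_alg :: "'u ring \<Rightarrow> 'u alg \<Rightarrow> bool" where
  "finite_alg A b \<longleftrightarrow> (\<exists>S. finite S \<and> S \<subseteq> carrier (fst b) \<and>
      (\<forall>y\<in>carrier (fst b). \<exists>c\<in>S \<rightarrow> carrier A.
         y = (\<Oplus>\<^bsub>fst b\<^esub>s\<in>S. snd b (c s) \<otimes>\<^bsub>fst b\<^esub> s)))"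

text \<open>\<open>p\<close> is the polynomial algebra over \<open>A\<close> in the variables \<open>X 0, \<dots>, X (n - 1)\<close>.\<close>

definition polynomial_alg :: "'u ring \<Rightarrow> nat \<Rightarrow> (nat \<Rightarrow> 'u) \<Rightarrow> 'u alg \<Rightarrow> bool" where
  "polynomial_alg A n X p \<longleftrightarrow> p \<in> algs A \<and> X \<in> {..<n} \<rightarrow> carrier (fst p) \<and>
     (\<forall>c\<in>algs A. \<forall>t\<in>{..<n} \<rightarrow> carrier (fst c). \<exists>!g. g \<in> alg_hom A p c \<and> (\<forall>i<n. g (X i) = t i))"

definition finite_presentation_alg :: "'u ring \<Rightarrow> 'u alg \<Rightarrow> bool" where
  "finite_presentation_alg A b \<longleftrightarrow> (\<exists>n X p g F. polynomial_alg A n X p \<and> g \<in> alg_hom A p b \<and>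
     g ` carrier (fst p) = carrier (fst b) \<and> finite F \<and> F \<subseteq> carrier (fst p) \<and>
     a_kernel (fst p) (fst b) g = Idl\<^bsub>fst p\<^esub> F)"

definition square_zero_ext :: "'u ring \<Rightarrow> 'u alg \<Rightarrow> 'u alg \<Rightarrow> ('u \<Rightarrow> 'u) \<Rightarrow> bool" where
  "square_zero_ext A c d \<pi> \<longleftrightarrow> c \<in> algs A \<and> d \<in> algs A \<and> \<pi> \<in> alg_hom A c d \<and>
     \<pi> ` carrier (fst c) = carrier (fst d) \<and>
     (\<forall>x\<in>a_kernel (fst c) (fst d) \<pi>. \<forall>y\<in>a_kernel (fst c) (fst d) \<pi>.
        x \<otimes>\<^bsub>fst c\<^esub> y = \<zero>\<^bsub>fst c\<^esub>)"

definition formally_smooth_alg :: "'u ring \<Rightarrow> 'u alg \<Rightarrow> bool" where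
  "formally_smooth_alg A b \<longleftrightarrow> (\<forall>c d \<pi>. square_zero_ext A c d \<pi> \<longrightarrow>
     (\<forall>g\<in>alg_hom A b d. \<exists>l\<in>alg_hom A b c. compose (carrier (fst b)) \<pi> l = g))"

definition formally_etale_alg :: "'u ring \<Rightarrow> 'u alg \<Rightarrow> bool" where
  "formally_etale_alg A b \<longleftrightarrow> (\<forall>c d \<pi>. square_zero_ext A c d \<pi> \<longrightarrow>
     (\<forall>g\<in>alg_hom A b d. \<exists>!l. l \<in> alg_hom A b c \<and> compose (carrier (fst b)) \<pi> l = g))"

definition smooth_alg :: "'u ring \<Rightarrow> 'u alg \<Rightarrow> bool" where
  "smooth_alg A b \<longleftrightarrow> finite_presentation_alg A b \<and> formally_smooth_alg A b"

definition etale_alg :: "'u ring \<Rightarrow> 'u alg \<Rightarrow> bool" where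
  "etale_alg A b \<longleftrightarrow> finite_presentation_alg A b \<and> formally_etale_alg A b"

definition localization_away :: "'u ring \<Rightarrow> 'u \<Rightarrow> 'u alg \<Rightarrow> bool" where
  "localization_away A f b \<longleftrightarrow> b \<in> algs A \<and> snd b f \<in> Units (fst b) \<and>
     (\<forall>c\<in>algs A. snd c f \<in> Units (fst c) \<longrightarrow> (\<exists>!g. g \<in> alg_hom A b c))"

definition jointly_surjective :: "'u ring \<Rightarrow> 'u alg set \<Rightarrow> bool" where
  "jointly_surjective A C \<longleftrightarrow> (\<forall>P. primeideal P A \<longrightarrow>
     (\<exists>b\<in>C. \<exists>Q. primeideal Q (fst b) \<and> {x \<in> carrier A. snd b x \<in> Q} = P))"


section \<open>Modules, flatness, sufficiently disconnected rings\<close>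

text \<open>Maps of modules that are linear along the ring homomorphism \<open>\<phi>\<close>.\<close>

definition semilinear ::
  "'u ring \<Rightarrow> ('u \<Rightarrow> 'u) \<Rightarrow> ('u, 'u) module \<Rightarrow> ('u, 'u) module \<Rightarrow> ('u \<Rightarrow> 'u) set" where
  "semilinear A \<phi> M N = {u \<in> carrier M \<rightarrow> carrier N. u \<in> extensional (carrier M) \<and>
     (\<forall>x\<in>carrier M. \<forall>y\<in>carrier M. u (x \<oplus>\<^bsub>M\<^esub> y) = u x \<oplus>\<^bsub>N\<^esub> u y) \<and>
     (\<forall>r\<in>carrier A. \<forall>x\<in>carrier M. u (r \<odot>\<^bsub>M\<^esub> x) = \<phi> r \<odot>\<^bsub>N\<^esub> u x)}"

abbreviation linear_maps ::
  "'u ring \<Rightarrow> ('u, 'u) module \<Rightarrow> ('u, 'u) module \<Rightarrow> ('u \<Rightarrow> 'u) set" where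
  "linear_maps A M N \<equiv> semilinear A (id_hom A) M N"

text \<open>\<open>\<iota> : M \<rightarrow> N\<close> exhibits the \<open>b\<close>-module \<open>N\<close> as the tensor product of \<open>M\<close> with \<open>b\<close> over \<open>A\<close>.\<close>

definition scalar_extension ::
  "'u ring \<Rightarrow> 'u alg \<Rightarrow> ('u, 'u) module \<Rightarrow> ('u, 'u) module \<Rightarrow> ('u \<Rightarrow> 'u) \<Rightarrow> bool" where
  "scalar_extension A b M N \<iota> \<longleftrightarrow> Module.module (fst b) N \<and> \<iota> \<in> semilinear A (snd b) M N \<and>
     (\<forall>Q :: ('u, 'u) module. Module.module (fst b) Q \<longrightarrow>
        (\<forall>u\<in>semilinear A (snd b) M Q.
           \<exists>!v. v \<in> linear_maps (fst b) N Q \<and> compose (carrier M) v \<iota> = u))"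

definition flat_alg :: "'u ring \<Rightarrow> 'u alg \<Rightarrow> bool" where
  "flat_alg A b \<longleftrightarrow> (\<forall>(M :: ('u, 'u) module) (M' :: ('u, 'u) module) N N' \<iota> \<iota>' u v.
     Module.module A M \<and> Module.module A M' \<and> u \<in> linear_maps A M M' \<and> inj_on u (carrier M) \<and>
     scalar_extension A b M N \<iota> \<and> scalar_extension A b M' N' \<iota>' \<and>
     v \<in> linear_maps (fst b) N N' \<and> compose (carrier M) v \<iota> = compose (carrier M) \<iota>' u
     \<longrightarrow> inj_on v (carrier N))"

definition faithfully_flat_alg :: "'u ring \<Rightarrow> 'u alg \<Rightarrow> bool" where
  "faithfully_flat_alg A b \<longleftrightarrow> flat_alg A b \<and> jointly_surjective A {b}"

definition fg_module :: "'u ring \<Rightarrow> ('u, 'u) module \<Rightarrow> bool" where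
  "fg_module A M \<longleftrightarrow> (\<exists>S. finite S \<and> S \<subseteq> carrier M \<and>
     (\<forall>x\<in>carrier M. \<exists>c\<in>S \<rightarrow> carrier A. x = (\<Oplus>\<^bsub>M\<^esub>s\<in>S. c s \<odot>\<^bsub>M\<^esub> s)))"

definition projective_module :: "'u ring \<Rightarrow> ('u, 'u) module \<Rightarrow> bool" where
  "projective_module A M \<longleftrightarrow> (\<forall>(N :: ('u, 'u) module) (Q :: ('u, 'u) module) g u.
     Module.module A N \<and> Module.module A Q \<and> g \<in> linear_maps A N Q \<and>
     g ` carrier N = carrier Q \<and> u \<in> linear_maps A M Q
     \<longrightarrow> (\<exists>l\<in>linear_maps A M N. compose (carrier M) g l = u))"

definition free_module :: "'u ring \<Rightarrow> ('u, 'u) module \<Rightarrow> bool" where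
  "free_module A M \<longleftrightarrow> (\<exists>S \<subseteq> carrier M. \<forall>x\<in>carrier M.
     \<exists>!c. c \<in> S \<rightarrow>\<^sub>E carrier A \<and> finite {s \<in> S. c s \<noteq> \<zero>\<^bsub>A\<^esub>} \<and>
       x = (\<Oplus>\<^bsub>M\<^esub>s\<in>{s \<in> S. c s \<noteq> \<zero>\<^bsub>A\<^esub>}. c s \<odot>\<^bsub>M\<^esub> s))"

definition sufficiently_disconnected :: "'u ring \<Rightarrow> bool" where
  "sufficiently_disconnected R \<longleftrightarrow> cring R \<and>
     (\<forall>M :: ('u, 'u) module. Module.module R M \<and> fg_module R M \<and> projective_module R M
        \<longrightarrow> free_module R M) \<and>
     (\<forall>b\<in>algs R. etale_alg R b \<and> faithfully_flat_alg R b \<longrightarrow>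
        (\<exists>c\<in>algs (fst b). finite_alg R (restr R (snd b) c) \<and> etale_alg R (restr R (snd b) c) \<and>
           faithfully_flat_alg R (restr R (snd b) c)))"

definition topological_ring :: "'u ring \<Rightarrow> 'u topology \<Rightarrow> bool" where
  "topological_ring R T \<longleftrightarrow> cring R \<and> topspace T = carrier R \<and> Hausdorff_space T \<and>
     continuous_map (prod_topology T T) T (\<lambda>(x, y). x \<oplus>\<^bsub>R\<^esub> y) \<and>
     continuous_map T T (\<lambda>x. \<ominus>\<^bsub>R\<^esub> x) \<and>
     continuous_map (prod_topology T T) T (\<lambda>(x, y). x \<otimes>\<^bsub>R\<^esub> y)"


section \<open>Presheaves and sheaves on affine schemes\<close>

text \<open>Functors from \<open>R\<close>-algebras to sets; \<open>res F a b h\<close> is the action of \<open>h \<in> alg_hom R a b\<close>.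
  Values outside \<open>algs R\<close> are irrelevant.\<close>

record ('u, 'x) psh =
  sec :: "'u alg \<Rightarrow> 'x set"
  res :: "'u alg \<Rightarrow> 'u alg \<Rightarrow> ('u \<Rightarrow> 'u) \<Rightarrow> 'x \<Rightarrow> 'x"

definition presheaf :: "'u ring \<Rightarrow> ('u, 'x) psh \<Rightarrow> bool" where
  "presheaf R F \<longleftrightarrow>
     (\<forall>a\<in>algs R. \<forall>b\<in>algs R. \<forall>h\<in>alg_hom R a b. res F a b h \<in> sec F a \<rightarrow> sec F b) \<and>
     (\<forall>a\<in>algs R. \<forall>x\<in>sec F a. res F a a (id_hom (fst a)) x = x) \<and>
     (\<forall>a\<in>algs R. \<forall>b\<in>algs R. \<forall>c\<in>algs R. \<forall>h\<in>alg_hom R a b. \<forall>k\<in>alg_hom R b c. \<forall>x\<in>sec F a.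
        res F a c (compose (carrier (fst a)) k h) x = res F b c k (res F a b h x))"

definition psh_hom ::
  "'u ring \<Rightarrow> ('u, 'x) psh \<Rightarrow> ('u, 'y) psh \<Rightarrow> ('u alg \<Rightarrow> 'x \<Rightarrow> 'y) \<Rightarrow> bool" where
  "psh_hom R X Y \<eta> \<longleftrightarrow> (\<forall>a\<in>algs R. \<eta> a \<in> sec X a \<rightarrow> sec Y a) \<and>
     (\<forall>a\<in>algs R. \<forall>b\<in>algs R. \<forall>h\<in>alg_hom R a b. \<forall>x\<in>sec X a.
        \<eta> b (res X a b h x) = res Y a b h (\<eta> a x))"

definition spec :: "'u ring \<Rightarrow> 'u alg \<Rightarrow> ('u, 'u \<Rightarrow> 'u) psh" where
  "spec R b = \<lparr>sec = \<lambda>c. alg_hom R b c, res = \<lambda>c d k g. compose (carrier (fst b)) k g\<rparr>"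

text \<open>The morphism \<open>Spec b \<rightarrow> F\<close> given by a section \<open>\<xi> \<in> F(b)\<close>.\<close>

definition yoneda :: "('u, 'x) psh \<Rightarrow> 'u alg \<Rightarrow> 'x \<Rightarrow> 'u alg \<Rightarrow> ('u \<Rightarrow> 'u) \<Rightarrow> 'x" where
  "yoneda F b \<xi> = (\<lambda>c g. res F b c g \<xi>)"

text \<open>The fibre product of \<open>\<eta> : X \<rightarrow> Y\<close> with \<open>y : Spec a \<rightarrow> Y\<close>, as a functor on \<open>fst a\<close>-algebras.\<close>

definition psh_fibre :: "'u ring \<Rightarrow> ('u, 'x) psh \<Rightarrow> ('u, 'y) psh \<Rightarrow> ('u alg \<Rightarrow> 'x \<Rightarrow> 'y) \<Rightarrow>
    'u alg \<Rightarrow> 'y \<Rightarrow> ('u, 'x) psh" where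
  "psh_fibre R X Y \<eta> a y = \<lparr>
     sec = \<lambda>c. {x \<in> sec X (restr R (snd a) c).
                  \<eta> (restr R (snd a) c) x = res Y a (restr R (snd a) c) (snd c) y},
     res = \<lambda>c d. res X (restr R (snd a) c) (restr R (snd a) d)\<rparr>"

definition zariski_cover :: "'u ring \<Rightarrow> 'u alg set \<Rightarrow> bool" where
  "zariski_cover A C \<longleftrightarrow> finite C \<and> (\<forall>b\<in>C. \<exists>f\<in>carrier A. localization_away A f b) \<and>
     jointly_surjective A C"

definition etale_cover :: "'u ring \<Rightarrow> 'u alg set \<Rightarrow> bool" where
  "etale_cover A C \<longleftrightarrow> finite C \<and> C \<subseteq> algs A \<and> (\<forall>b\<in>C. etale_alg A b) \<and> jointly_surjective A C"

definition matching_family ::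
  "'u ring \<Rightarrow> ('u, 'x) psh \<Rightarrow> 'u alg \<Rightarrow> 'u alg set \<Rightarrow> ('u alg \<Rightarrow> 'x) \<Rightarrow> bool" where
  "matching_family R F a C s \<longleftrightarrow> (\<forall>b\<in>C. s b \<in> sec F (restr R (snd a) b)) \<and>
     (\<forall>b\<in>C. \<forall>b'\<in>C. \<forall>c\<in>algs (fst a). \<forall>g\<in>alg_hom (fst a) b c. \<forall>g'\<in>alg_hom (fst a) b' c.
        res F (restr R (snd a) b) (restr R (snd a) c) g (s b) =
        res F (restr R (snd a) b') (restr R (snd a) c) g' (s b'))"

definition sheaf :: "('u ring \<Rightarrow> 'u alg set \<Rightarrow> bool) \<Rightarrow> 'u ring \<Rightarrow> ('u, 'x) psh \<Rightarrow> bool" where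
  "sheaf covering R F \<longleftrightarrow> presheaf R F \<and>
     (\<forall>a\<in>algs R. \<forall>C s. covering (fst a) C \<and> matching_family R F a C s \<longrightarrow>
        (\<exists>!x. x \<in> sec F a \<and> (\<forall>b\<in>C. res F a (restr R (snd a) b) (snd b) x = s b)))"

text \<open>Surjectivity is tested on points with values in fields, up to extension of the field.\<close>

definition surjective_on_base :: "'u ring \<Rightarrow> ('u, 'x) psh \<Rightarrow> bool" where
  "surjective_on_base A F \<longleftrightarrow> (\<forall>k\<in>algs A. Ring.field (fst k) \<longrightarrow>
     (\<exists>K\<in>algs (fst k). Ring.field (fst K) \<and> sec F (restr A (snd k) K) \<noteq> {}))"

definition family_surjective :: "'u ring \<Rightarrow> ('u, 'x) psh \<Rightarrow> ('u alg \<times> 'x) set \<Rightarrow> bool" where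
  "family_surjective A F U \<longleftrightarrow> (\<forall>k\<in>algs A. Ring.field (fst k) \<longrightarrow> (\<forall>y\<in>sec F k.
     \<exists>K\<in>algs (fst k). Ring.field (fst K) \<and>
       (\<exists>(b, \<xi>)\<in>U. \<exists>g\<in>alg_hom A b (restr A (snd k) K).
          yoneda F b \<xi> (restr A (snd k) K) g = res F k (restr A (snd k) K) (snd K) y)))"


section \<open>Schemes\<close>

text \<open>Every base change to \<open>Spec a\<close> is the inclusion of the open complement of an ideal \<open>I\<close>.\<close>

definition open_immersion ::
  "'u ring \<Rightarrow> ('u, 'x) psh \<Rightarrow> ('u, 'y) psh \<Rightarrow> ('u alg \<Rightarrow> 'x \<Rightarrow> 'y) \<Rightarrow> bool" where
  "open_immersion R X Y \<eta> \<longleftrightarrow> psh_hom R X Y \<eta> \<and>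
     (\<forall>a\<in>algs R. \<forall>y\<in>sec Y a. \<exists>I. ideal I (fst a) \<and> (\<forall>c\<in>algs (fst a).
        if Idl\<^bsub>fst c\<^esub> (snd c ` I) = carrier (fst c)
        then \<exists>!x. x \<in> sec (psh_fibre R X Y \<eta> a y) c
        else sec (psh_fibre R X Y \<eta> a y) c = {}))"

definition closed_immersion ::
  "'u ring \<Rightarrow> ('u, 'x) psh \<Rightarrow> ('u, 'y) psh \<Rightarrow> ('u alg \<Rightarrow> 'x \<Rightarrow> 'y) \<Rightarrow> bool" where
  "closed_immersion R X Y \<eta> \<longleftrightarrow> psh_hom R X Y \<eta> \<and>
     (\<forall>a\<in>algs R. \<forall>y\<in>sec Y a. \<exists>I. ideal I (fst a) \<and> (\<forall>c\<in>algs (fst a).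
        if snd c ` I \<subseteq> {\<zero>\<^bsub>fst c\<^esub>}
        then \<exists>!x. x \<in> sec (psh_fibre R X Y \<eta> a y) c
        else sec (psh_fibre R X Y \<eta> a y) c = {}))"

definition open_affine_cover :: "'u ring \<Rightarrow> ('u, 'x) psh \<Rightarrow> ('u alg \<times> 'x) set \<Rightarrow> bool" where
  "open_affine_cover A F U \<longleftrightarrow>
     (\<forall>(b, \<xi>)\<in>U. b \<in> algs A \<and> \<xi> \<in> sec F b \<and> open_immersion A (spec A b) F (yoneda F b \<xi>)) \<and>
     family_surjective A F U"

definition scheme :: "'u ring \<Rightarrow> ('u, 'x) psh \<Rightarrow> bool" where
  "scheme A F \<longleftrightarrow> sheaf zariski_cover A F \<and> (\<exists>U. open_affine_cover A F U)"

definition finite_type_scheme :: "'u ring \<Rightarrow> ('u, 'x) psh \<Rightarrow> bool" where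
  "finite_type_scheme A F \<longleftrightarrow> sheaf zariski_cover A F \<and>
     (\<exists>U. finite U \<and> open_affine_cover A F U \<and> (\<forall>(b, \<xi>)\<in>U. finite_type_alg A b))"

definition smooth_scheme :: "'u ring \<Rightarrow> ('u, 'x) psh \<Rightarrow> bool" where
  "smooth_scheme A F \<longleftrightarrow> sheaf zariski_cover A F \<and>
     (\<exists>U. open_affine_cover A F U \<and> (\<forall>(b, \<xi>)\<in>U. smooth_alg A b))"

definition etale_scheme :: "'u ring \<Rightarrow> ('u, 'x) psh \<Rightarrow> bool" where
  "etale_scheme A F \<longleftrightarrow> sheaf zariski_cover A F \<and>
     (\<exists>U. open_affine_cover A F U \<and> (\<forall>(b, \<xi>)\<in>U. etale_alg A b))"

definition smooth_morphism ::
  "'u ring \<Rightarrow> ('u, 'x) psh \<Rightarrow> ('u, 'y) psh \<Rightarrow> ('u alg \<Rightarrow> 'x \<Rightarrow> 'y) \<Rightarrow> bool" where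
  "smooth_morphism R X Y \<eta> \<longleftrightarrow> psh_hom R X Y \<eta> \<and>
     (\<forall>a\<in>algs R. \<forall>y\<in>sec Y a. smooth_scheme (fst a) (psh_fibre R X Y \<eta> a y))"

definition etale_morphism ::
  "'u ring \<Rightarrow> ('u, 'x) psh \<Rightarrow> ('u, 'y) psh \<Rightarrow> ('u alg \<Rightarrow> 'x \<Rightarrow> 'y) \<Rightarrow> bool" where
  "etale_morphism R X Y \<eta> \<longleftrightarrow> psh_hom R X Y \<eta> \<and>
     (\<forall>a\<in>algs R. \<forall>y\<in>sec Y a. etale_scheme (fst a) (psh_fibre R X Y \<eta> a y))"

definition affine_line :: "'u ring \<Rightarrow> ('u, 'u) psh" where
  "affine_line R = \<lparr>sec = \<lambda>a. carrier (fst a), res = \<lambda>a b h. h\<rparr>"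

text \<open>\<open>P\<close> with projections \<open>p\<close>, \<open>q\<close> is a product of \<open>X\<close> and \<open>Y\<close> over \<open>R\<close>; products of functors
  are formed pointwise.\<close>

definition psh_product :: "'u ring \<Rightarrow> ('u, 'x) psh \<Rightarrow> ('u, 'y) psh \<Rightarrow> ('u, 'z) psh \<Rightarrow>
    ('u alg \<Rightarrow> 'z \<Rightarrow> 'x) \<Rightarrow> ('u alg \<Rightarrow> 'z \<Rightarrow> 'y) \<Rightarrow> bool" where
  "psh_product R X Y P p q \<longleftrightarrow> psh_hom R P X p \<and> psh_hom R P Y q \<and>
     (\<forall>a\<in>algs R. bij_betw (\<lambda>z. (p a z, q a z)) (sec P a) (sec X a \<times> sec Y a))"

text \<open>Along \<open>\<rho> : R \<rightarrow> R'\<close>: the \<open>A\<close>-points of the base change of \<open>F\<close>, for an \<open>R'\<close>-algebra \<open>A\<close>, are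
  the \<open>A\<close>-points of \<open>F\<close>.\<close>

definition psh_base_change :: "'u ring \<Rightarrow> ('u \<Rightarrow> 'u) \<Rightarrow> ('u, 'x) psh \<Rightarrow> ('u, 'x) psh" where
  "psh_base_change R \<rho> F = \<lparr>sec = \<lambda>a. sec F (restr R \<rho> a),
     res = \<lambda>a b. res F (restr R \<rho> a) (restr R \<rho> b)\<rparr>"

definition good_topologization ::
  "'u ring \<Rightarrow> 'u topology \<Rightarrow> (('u, 'u) psh \<Rightarrow> 'u topology) \<Rightarrow> bool" where
  "good_topologization R T \<tau> \<longleftrightarrow>
     (\<forall>X. finite_type_scheme R X \<longrightarrow> topspace (\<tau> X) = sec X (self_alg R)) \<and>
     \<tau> (affine_line R) = T \<and>
     (\<forall>X Y \<eta>. finite_type_scheme R X \<and> finite_type_scheme R Y \<and> psh_hom R X Y \<eta> \<longrightarrow>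
        continuous_map (\<tau> X) (\<tau> Y) (\<eta> (self_alg R))) \<and>
     (\<forall>X Y \<eta>. finite_type_scheme R X \<and> finite_type_scheme R Y \<and> closed_immersion R Y X \<eta> \<longrightarrow>
        embedding_map (\<tau> Y) (\<tau> X) (\<eta> (self_alg R)) \<and>
        closedin (\<tau> X) (\<eta> (self_alg R) ` sec Y (self_alg R))) \<and>
     (\<forall>X Y P p q. finite_type_scheme R X \<and> finite_type_scheme R Y \<and> finite_type_scheme R P \<and>
        psh_product R X Y P p q \<longrightarrow>
        homeomorphic_map (\<tau> P) (prod_topology (\<tau> X) (\<tau> Y))
          (\<lambda>z. (p (self_alg R) z, q (self_alg R) z)))"

definition smooth_quotient_property ::
  "'u ring \<Rightarrow> (('u, 'u) psh \<Rightarrow> 'u topology) \<Rightarrow> bool" where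
  "smooth_quotient_property R \<tau> \<longleftrightarrow>
     (\<forall>X Y \<eta>. finite_type_scheme R X \<and> finite_type_scheme R Y \<and> smooth_morphism R X Y \<eta> \<and>
        \<eta> (self_alg R) ` sec X (self_alg R) = sec Y (self_alg R) \<longrightarrow>
        quotient_map (\<tau> X) (\<tau> Y) (\<eta> (self_alg R)))"


section \<open>Algebraic spaces\<close>

text \<open>The fibre product of the diagonal of \<open>F\<close> with \<open>(x, y) : Spec a \<rightarrow> F \<times> F\<close>.\<close>

definition equalizer_psh ::
  "'u ring \<Rightarrow> ('u, 'x) psh \<Rightarrow> 'u alg \<Rightarrow> 'x \<Rightarrow> 'x \<Rightarrow> ('u, unit) psh" where
  "equalizer_psh R F a x y = \<lparr>
     sec = \<lambda>c. {_. res F a (restr R (snd a) c) (snd c) x = res F a (restr R (snd a) c) (snd c) y},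
     res = \<lambda>c d k u. u\<rparr>"

text \<open>The atlas of an algebraic space is taken to be a disjoint union of affine schemes; it is
  given as the family of its components. (Any scheme atlas is refined by such a one.)\<close>

definition etale_atlas :: "'u ring \<Rightarrow> ('u, 'x) psh \<Rightarrow> ('u alg \<times> 'x) set \<Rightarrow> bool" where
  "etale_atlas A F U \<longleftrightarrow>
     (\<forall>(b, \<xi>)\<in>U. b \<in> algs A \<and> \<xi> \<in> sec F b \<and> etale_morphism A (spec A b) F (yoneda F b \<xi>)) \<and>
     family_surjective A F U"

definition representable_diagonal :: "'u ring \<Rightarrow> ('u, 'x) psh \<Rightarrow> bool" where
  "representable_diagonal A F \<longleftrightarrow>
     (\<forall>a\<in>algs A. \<forall>x\<in>sec F a. \<forall>y\<in>sec F a. scheme (fst a) (equalizer_psh A F a x y))"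

definition algebraic_space :: "'u ring \<Rightarrow> ('u, 'x) psh \<Rightarrow> bool" where
  "algebraic_space A F \<longleftrightarrow> sheaf etale_cover A F \<and> representable_diagonal A F \<and>
     (\<exists>U. etale_atlas A F U)"

definition smooth_algebraic_space :: "'u ring \<Rightarrow> ('u, 'x) psh \<Rightarrow> bool" where
  "smooth_algebraic_space A F \<longleftrightarrow> algebraic_space A F \<and>
     (\<exists>U. etale_atlas A F U \<and> (\<forall>(b, \<xi>)\<in>U. smooth_alg A b))"


section \<open>Stacks\<close>

text \<open>A category over the category of affine schemes: \<open>bas\<close> and \<open>ovr\<close> are the projection
  functor. As \<open>Spec\<close> is contravariant, \<open>f \<in> arr y x\<close> lies over an algebra homomorphism from
  \<open>bas x\<close> to \<open>bas y\<close>. \<open>cmp g f\<close> is \<open>g\<close> after \<open>f\<close>.\<close>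

record ('u, 'o, 'm) fibcat =
  obj :: "'o set"
  arr :: "'o \<Rightarrow> 'o \<Rightarrow> 'm set"
  idm :: "'o \<Rightarrow> 'm"
  cmp :: "'m \<Rightarrow> 'm \<Rightarrow> 'm"
  bas :: "'o \<Rightarrow> 'u alg"
  ovr :: "'m \<Rightarrow> ('u \<Rightarrow> 'u)"

definition id_over :: "('u, 'o, 'm) fibcat \<Rightarrow> 'o \<Rightarrow> ('u \<Rightarrow> 'u)" where
  "id_over X x = id_hom (fst (bas X x))"

locale fibred_in_groupoids =
  fixes R :: "'u ring" and X :: "('u, 'o, 'm) fibcat"
  assumes idm_arr: "x \<in> obj X \<Longrightarrow> idm X x \<in> arr X x x"
    and cmp_arr: "\<lbrakk>x \<in> obj X; y \<in> obj X; z \<in> obj X; f \<in> arr X x y; g \<in> arr X y z\<rbrakk>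
      \<Longrightarrow> cmp X g f \<in> arr X x z"
    and cmp_idm_right: "\<lbrakk>x \<in> obj X; y \<in> obj X; f \<in> arr X x y\<rbrakk> \<Longrightarrow> cmp X f (idm X x) = f"
    and cmp_idm_left: "\<lbrakk>x \<in> obj X; y \<in> obj X; f \<in> arr X x y\<rbrakk> \<Longrightarrow> cmp X (idm X y) f = f"
    and cmp_assoc: "\<lbrakk>w \<in> obj X; x \<in> obj X; y \<in> obj X; z \<in> obj X;
      f \<in> arr X w x; g \<in> arr X x y; e \<in> arr X y z\<rbrakk>
      \<Longrightarrow> cmp X e (cmp X g f) = cmp X (cmp X e g) f"
    and bas_alg: "x \<in> obj X \<Longrightarrow> bas X x \<in> algs R"
    and ovr_hom: "\<lbrakk>x \<in> obj X; y \<in> obj X; f \<in> arr X x y\<rbrakk>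
      \<Longrightarrow> ovr X f \<in> alg_hom R (bas X y) (bas X x)"
    and ovr_idm: "x \<in> obj X \<Longrightarrow> ovr X (idm X x) = id_over X x"
    and ovr_cmp: "\<lbrakk>x \<in> obj X; y \<in> obj X; z \<in> obj X; f \<in> arr X x y; g \<in> arr X y z\<rbrakk>
      \<Longrightarrow> ovr X (cmp X g f) = compose (carrier (fst (bas X z))) (ovr X f) (ovr X g)"
    and pullback: "\<lbrakk>x \<in> obj X; b \<in> algs R; h \<in> alg_hom R (bas X x) b\<rbrakk>
      \<Longrightarrow> \<exists>y\<in>obj X. bas X y = b \<and> (\<exists>f\<in>arr X y x. ovr X f = h)"
    and cartesian: "\<lbrakk>x \<in> obj X; y \<in> obj X; z \<in> obj X; f \<in> arr X y x; g \<in> arr X z x;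
      h \<in> alg_hom R (bas X y) (bas X z);
      compose (carrier (fst (bas X x))) h (ovr X f) = ovr X g\<rbrakk>
      \<Longrightarrow> \<exists>!k. k \<in> arr X z y \<and> ovr X k = h \<and> cmp X f k = g"

text \<open>Descent is formulated with the sieve generated by a covering, so that no pullbacks and no
  fibre products of the covering have to be chosen: the functor from sections over \<open>A\<close> to
  cartesian sections over the sieve is fully faithful (the first condition below) and
  essentially surjective (the second condition).\<close>

definition cover_sieve :: "'u ring \<Rightarrow> 'u alg set \<Rightarrow> 'u alg set" where
  "cover_sieve A C = {b \<in> algs A. \<exists>c\<in>C. alg_hom A c b \<noteq> {}}"

definition over_sieve :: "('u, 'o, 'm) fibcat \<Rightarrow> 'u alg set \<Rightarrow> 'o \<Rightarrow> 'o \<Rightarrow> 'm \<Rightarrow> bool" where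
  "over_sieve X C x w p \<longleftrightarrow> w \<in> obj X \<and> p \<in> arr X w x \<and>
     (fst (bas X w), ovr X p) \<in> cover_sieve (fst (bas X x)) C"

definition morphisms_glue :: "('u, 'o, 'm) fibcat \<Rightarrow> bool" where
  "morphisms_glue X \<longleftrightarrow> (\<forall>x\<in>obj X. \<forall>y\<in>obj X. \<forall>C k. bas X x = bas X y \<and>
     etale_cover (fst (bas X x)) C \<and>
     (\<forall>w p. over_sieve X C x w p \<longrightarrow> k w p \<in> arr X w y \<and> ovr X (k w p) = ovr X p) \<and>
     (\<forall>w p w' q. over_sieve X C x w p \<and> w' \<in> obj X \<and> q \<in> arr X w' w \<longrightarrow>
        k w' (cmp X p q) = cmp X (k w p) q)
     \<longrightarrow> (\<exists>!f. f \<in> arr X x y \<and> ovr X f = id_over X x \<and>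
            (\<forall>w p. over_sieve X C x w p \<longrightarrow> cmp X f p = k w p)))"

definition descent_datum :: "'u ring \<Rightarrow> ('u, 'o, 'm) fibcat \<Rightarrow> 'u alg \<Rightarrow> 'u alg set \<Rightarrow>
    ('u alg \<Rightarrow> 'o) \<Rightarrow> ('u alg \<Rightarrow> 'u alg \<Rightarrow> ('u \<Rightarrow> 'u) \<Rightarrow> 'm) \<Rightarrow> bool" where
  "descent_datum R X a S d m \<longleftrightarrow>
     (\<forall>b\<in>S. d b \<in> obj X \<and> bas X (d b) = restr R (snd a) b) \<and>
     (\<forall>b\<in>S. \<forall>c\<in>S. \<forall>g\<in>alg_hom (fst a) b c. m b c g \<in> arr X (d c) (d b) \<and> ovr X (m b c g) = g) \<and>
     (\<forall>b\<in>S. m b b (id_hom (fst b)) = idm X (d b)) \<and>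
     (\<forall>b\<in>S. \<forall>c\<in>S. \<forall>e\<in>S. \<forall>g\<in>alg_hom (fst a) b c. \<forall>h\<in>alg_hom (fst a) c e.
        m b e (compose (carrier (fst b)) h g) = cmp X (m b c g) (m c e h))"

definition objects_glue :: "'u ring \<Rightarrow> ('u, 'o, 'm) fibcat \<Rightarrow> bool" where
  "objects_glue R X \<longleftrightarrow> (\<forall>a\<in>algs R. \<forall>C d m.
     etale_cover (fst a) C \<and> descent_datum R X a (cover_sieve (fst a) C) d m \<longrightarrow>
     (\<exists>x\<in>obj X. bas X x = a \<and> (\<exists>e.
        (\<forall>b\<in>cover_sieve (fst a) C. e b \<in> arr X (d b) x \<and> ovr X (e b) = snd b) \<and>
        (\<forall>b\<in>cover_sieve (fst a) C. \<forall>c\<in>cover_sieve (fst a) C. \<forall>g\<in>alg_hom (fst a) b c.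
           cmp X (e b) (m b c g) = e c))))"

definition stack :: "'u ring \<Rightarrow> ('u, 'o, 'm) fibcat \<Rightarrow> bool" where
  "stack R X \<longleftrightarrow> fibred_in_groupoids R X \<and> morphisms_glue X \<and> objects_glue R X"

text \<open>The presheaf \<open>Isom(x, y)\<close> on algebras over the common base of \<open>x\<close> and \<open>y\<close>. An isomorphism
  between pullbacks of \<open>x\<close> and \<open>y\<close> is represented by a span \<open>x \<leftarrow> w \<rightarrow> y\<close>, up to isomorphism
  of \<open>w\<close>, since pullbacks are only determined up to isomorphism.\<close>

definition isom_spans ::
  "'u ring \<Rightarrow> ('u, 'o, 'm) fibcat \<Rightarrow> 'o \<Rightarrow> 'o \<Rightarrow> 'u alg \<Rightarrow> ('o \<times> 'm \<times> 'm) set" where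
  "isom_spans R X x y c = {(w, p, q). w \<in> obj X \<and> bas X w = restr R (snd (bas X x)) c \<and>
     p \<in> arr X w x \<and> q \<in> arr X w y \<and> ovr X p = snd c \<and> ovr X q = snd c}"

definition pulled_back_spans :: "'u ring \<Rightarrow> ('u, 'o, 'm) fibcat \<Rightarrow> 'o \<Rightarrow> 'o \<Rightarrow> 'u alg \<Rightarrow>
    ('u \<Rightarrow> 'u) \<Rightarrow> ('o \<times> 'm \<times> 'm) set \<Rightarrow> ('o \<times> 'm \<times> 'm) set" where
  "pulled_back_spans R X x y d k S = {(w', p', q') \<in> isom_spans R X x y d.
     \<exists>(w, p, q)\<in>S. \<exists>i\<in>arr X w' w. ovr X i = k \<and> p' = cmp X p i \<and> q' = cmp X q i}"

definition isom_psh ::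
  "'u ring \<Rightarrow> ('u, 'o, 'm) fibcat \<Rightarrow> 'o \<Rightarrow> 'o \<Rightarrow> ('u, ('o \<times> 'm \<times> 'm) set) psh" where
  "isom_psh R X x y = \<lparr>
     sec = \<lambda>c. {pulled_back_spans R X x y c (id_hom (fst c)) {s} | s. s \<in> isom_spans R X x y c},
     res = \<lambda>c d k. pulled_back_spans R X x y d k\<rparr>"

text \<open>A morphism from a presheaf \<open>Z\<close> to \<open>X\<close>: a functor over affine schemes from the category of
  elements of \<open>Z\<close> to \<open>X\<close>.\<close>

definition stack_hom :: "'u ring \<Rightarrow> ('u, 'z) psh \<Rightarrow> ('u, 'o, 'm) fibcat \<Rightarrow>
    ('u alg \<Rightarrow> 'z \<Rightarrow> 'o) \<Rightarrow> ('u alg \<Rightarrow> 'u alg \<Rightarrow> ('u \<Rightarrow> 'u) \<Rightarrow> 'z \<Rightarrow> 'm) \<Rightarrow> bool" where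
  "stack_hom R Z X fo fm \<longleftrightarrow>
     (\<forall>a\<in>algs R. \<forall>z\<in>sec Z a. fo a z \<in> obj X \<and> bas X (fo a z) = a) \<and>
     (\<forall>a\<in>algs R. \<forall>b\<in>algs R. \<forall>h\<in>alg_hom R a b. \<forall>z\<in>sec Z a.
        fm a b h z \<in> arr X (fo b (res Z a b h z)) (fo a z) \<and> ovr X (fm a b h z) = h) \<and>
     (\<forall>a\<in>algs R. \<forall>z\<in>sec Z a. fm a a (id_hom (fst a)) z = idm X (fo a z)) \<and>
     (\<forall>a\<in>algs R. \<forall>b\<in>algs R. \<forall>c\<in>algs R. \<forall>h\<in>alg_hom R a b. \<forall>k\<in>alg_hom R b c. \<forall>z\<in>sec Z a.
        fm a c (compose (carrier (fst a)) k h) z = cmp X (fm a b h z) (fm b c k (res Z a b h z)))"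

text \<open>The 2-fibre product of \<open>Z \<rightarrow> X\<close> with the morphism \<open>Spec (bas X x) \<rightarrow> X\<close> given by \<open>x\<close>. A
  morphism from \<open>fo z\<close> to \<open>x\<close> over \<open>Spec c \<rightarrow> Spec (bas X x)\<close> is the same as an isomorphism of
  \<open>fo z\<close> with the pullback of \<open>x\<close>.\<close>

definition stack_fibre :: "'u ring \<Rightarrow> ('u, 'z) psh \<Rightarrow> ('u, 'o, 'm) fibcat \<Rightarrow>
    ('u alg \<Rightarrow> 'z \<Rightarrow> 'o) \<Rightarrow> ('u alg \<Rightarrow> 'u alg \<Rightarrow> ('u \<Rightarrow> 'u) \<Rightarrow> 'z \<Rightarrow> 'm) \<Rightarrow> 'o \<Rightarrow>
    ('u, 'z \<times> 'm) psh" where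
  "stack_fibre R Z X fo fm x = (let r = restr R (snd (bas X x)) in \<lparr>
     sec = \<lambda>c. {(z, p). c \<in> algs (fst (bas X x)) \<and> z \<in> sec Z (r c) \<and>
                     p \<in> arr X (fo (r c) z) x \<and> ovr X p = snd c},
     res = \<lambda>c d k (z, p). (res Z (r c) (r d) k z, cmp X p (fm (r c) (r d) k z))\<rparr>)"

definition smooth_cover :: "'u ring \<Rightarrow> ('u, 'z) psh \<Rightarrow> ('u, 'o, 'm) fibcat \<Rightarrow>
    ('u alg \<Rightarrow> 'z \<Rightarrow> 'o) \<Rightarrow> ('u alg \<Rightarrow> 'u alg \<Rightarrow> ('u \<Rightarrow> 'u) \<Rightarrow> 'z \<Rightarrow> 'm) \<Rightarrow> bool" where
  "smooth_cover R Z X fo fm \<longleftrightarrow> stack_hom R Z X fo fm \<and>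
     (\<forall>x\<in>obj X. smooth_algebraic_space (fst (bas X x)) (stack_fibre R Z X fo fm x) \<and>
        surjective_on_base (fst (bas X x)) (stack_fibre R Z X fo fm x))"

text \<open>Algebraic stacks of finite type over \<open>R\<close>: an algebraic stack is of finite type (quasi-compact
  and locally of finite type) iff it has a smooth cover by a scheme of finite type.\<close>

definition algebraic_stack :: "'u ring \<Rightarrow> ('u, 'o, 'm) fibcat \<Rightarrow> bool" where
  "algebraic_stack R X \<longleftrightarrow> stack R X \<and>
     (\<forall>x\<in>obj X. \<forall>y\<in>obj X. bas X x = bas X y \<longrightarrow>
        algebraic_space (fst (bas X x)) (isom_psh R X x y)) \<and>
     (\<exists>(Z :: ('u, 'u) psh) fo fm. finite_type_scheme R Z \<and> smooth_cover R Z X fo fm)"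

text \<open>The 2-fibre product of \<open>X\<close> with \<open>Spec R'\<close> along \<open>\<rho> : R \<rightarrow> R'\<close>: an object is an object of \<open>X\<close>
  together with an \<open>R'\<close>-algebra whose underlying \<open>R\<close>-algebra is the base of the object.\<close>

definition stack_base_change :: "'u ring \<Rightarrow> 'u ring \<Rightarrow> ('u \<Rightarrow> 'u) \<Rightarrow> ('u, 'o, 'm) fibcat \<Rightarrow>
    ('u, 'o \<times> 'u alg, 'm) fibcat" where
  "stack_base_change R R' \<rho> X = \<lparr>
     obj = {(x, a). x \<in> obj X \<and> a \<in> algs R' \<and> bas X x = restr R \<rho> a},
     arr = \<lambda>(x, a) (y, b). {f \<in> arr X x y. ovr X f \<in> alg_hom R' b a},
     idm = \<lambda>(x, a). idm X x,
     cmp = cmp X,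
     bas = snd,
     ovr = ovr X\<rparr>"


section \<open>The topology on the points of a stack\<close>

text \<open>Isomorphisms are the morphisms over the identity, as the fibres are groupoids.\<close>

definition iso_class :: "('u, 'o, 'm) fibcat \<Rightarrow> 'o \<Rightarrow> 'o set" where
  "iso_class X x = {y \<in> obj X. bas X y = bas X x \<and> (\<exists>f\<in>arr X y x. ovr X f = id_over X x)}"

definition stack_points :: "'u ring \<Rightarrow> ('u, 'o, 'm) fibcat \<Rightarrow> 'o set set" where
  "stack_points R X = iso_class X ` {x \<in> obj X. bas X x = self_alg R}"

definition stack_open ::
  "'u ring \<Rightarrow> (('u, 'u) psh \<Rightarrow> 'u topology) \<Rightarrow> ('u, 'o, 'm) fibcat \<Rightarrow> 'o set set \<Rightarrow> bool" where
  "stack_open R \<tau> X W \<longleftrightarrow> W \<subseteq> stack_points R X \<and>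
     (\<forall>Z fo fm. finite_type_scheme R Z \<and> smooth_cover R Z X fo fm \<longrightarrow>
        openin (\<tau> Z) {z \<in> sec Z (self_alg R). iso_class X (fo (self_alg R) z) \<in> W})"

definition stack_topology ::
  "'u ring \<Rightarrow> (('u, 'u) psh \<Rightarrow> 'u topology) \<Rightarrow> ('u, 'o, 'm) fibcat \<Rightarrow> 'o set topology" where
  "stack_topology R \<tau> X = topology (stack_open R \<tau> X)"

text \<open>The natural map from \<open>R\<close>-points of \<open>X\<close> to \<open>R'\<close>-points of the base change of \<open>X\<close> along \<open>\<rho>\<close>.
  The set of all pullbacks along \<open>\<rho>\<close> of the objects in an isomorphism class is an isomorphism
  class.\<close>

definition stack_point_map :: "'u ring \<Rightarrow> ('u \<Rightarrow> 'u) \<Rightarrow> ('u, 'o, 'm) fibcat \<Rightarrow>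
    'o set \<Rightarrow> ('o \<times> 'u alg) set" where
  "stack_point_map R' \<rho> X P = {(w, self_alg R') | w. w \<in> obj X \<and> bas X w = (R', \<rho>) \<and>
     (\<exists>x\<in>P. \<exists>f\<in>arr X w x. ovr X f = \<rho>)}"

end

theory Submission
  imports Defs
begin

text \<open>
  A smooth cover \<open>Z \<rightarrow> X\<close> by a scheme of finite type base changes to a smooth cover of \<open>X\<^sub>R\<^sub>'\<close>. The
  preimage in \<open>Z(R)\<close> of an open set of \<open>R'\<close>-points of \<open>X\<^sub>R\<^sub>'\<close> is its preimage under
  \<open>Z(R) \<rightarrow> Z(R') \<rightarrow> X(R')\<close>. The first map is continuous by hypothesis and preimages under the second
  are open by definition of the topology.
\<close>

section \<open>Algebras and restriction of scalars\<close>

text \<open>Base change of a functor of points is mere restriction of scalars on the test algebras,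
  so the sheaf condition and the smoothness and surjectivity of a cover are inherited with the same
  rings, coverings and fibres. What is not inherited is the finite affine cover of \<open>Z\<close>:
  its charts have to be represented again over \<open>R'\<close>. The tensor product of a chart with
  \<open>R'\<close> must therefore be built with carrier in the fixed type \<open>'u\<close>, and
  this is where the infinity of \<open>'u\<close> enters. On points, the natural map sends a class
  to the set of all pullbacks of its members, so the openness argument can use the arrow over
  \<open>\<rho>\<close> that the cover \<open>Z\<close> itself provides.\<close>

lemma id_hom_ring_hom: "ring A \<Longrightarrow> id_hom A \<in> ring_hom A A"
  by (auto simp: id_hom_def intro!: ring_hom_memI ring.ring_simprules)

lemma id_hom_extensional: "id_hom A \<in> extensional (carrier A)"
  by (simp add: id_hom_def)

lemma ring_hom_compose:
  assumes "f \<in> ring_hom A B" "g \<in> ring_hom B C" "ring A"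
  shows "compose (carrier A) g f \<in> ring_hom A C"
proof (rule ring_hom_memI)
  show "compose (carrier A) g f \<one>\<^bsub>A\<^esub> = \<one>\<^bsub>C\<^esub>"
    using assms(3) ring.ring_simprules(6)[OF assms(3)]
    by (simp add: compose_def ring_hom_one[OF assms(1)] ring_hom_one[OF assms(2)])
qed (simp_all add: compose_def ring.ring_simprules(1,5)[OF assms(3)] ring_hom_closed[OF assms(1)]
    ring_hom_closed[OF assms(2)] ring_hom_add[OF assms(1)] ring_hom_add[OF assms(2)]
    ring_hom_mult[OF assms(1)] ring_hom_mult[OF assms(2)])

lemma algsI:
  "\<lbrakk>cring (fst a); snd a \<in> ring_hom R (fst a); snd a \<in> extensional (carrier R)\<rbrakk> \<Longrightarrow> a \<in> algs R"
  by (auto simp: algs_def split: prod.splits)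

lemma algsD:
  assumes "a \<in> algs R"
  shows "cring (fst a)" "snd a \<in> ring_hom R (fst a)" "snd a \<in> extensional (carrier R)"
  using assms by (auto simp: algs_def)

lemma fst_restr [simp]: "fst (restr R \<phi> b) = fst b"
  by (simp add: restr_def)

lemma compose_id_hom_left:
  "\<lbrakk>f \<in> carrier A \<rightarrow> carrier B; f \<in> extensional (carrier A)\<rbrakk> \<Longrightarrow> compose (carrier A) (id_hom B) f = f"
  by (auto simp: id_hom_def compose_def extensional_def fun_eq_iff Pi_iff)

lemma compose_id_hom_right:
  "f \<in> extensional (carrier A) \<Longrightarrow> compose (carrier A) f (id_hom A) = f"
  by (auto simp: id_hom_def compose_def extensional_def fun_eq_iff)

lemma fst_self_alg: "fst (self_alg R) = R"
  by (simp add: self_alg_def)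

lemma self_alg_algs: "cring R \<Longrightarrow> self_alg R \<in> algs R"
  by (simp add: self_alg_def algsI id_hom_ring_hom id_hom_extensional cring.axioms(1))

lemma presheaf_res_closed:
  "\<lbrakk>presheaf R F; a \<in> algs R; b \<in> algs R; h \<in> alg_hom R a b; x \<in> sec F a\<rbrakk> \<Longrightarrow> res F a b h x \<in> sec F b"
  by (auto simp: presheaf_def)

text \<open>Stated for an arbitrary homomorphism because it is also instantiated with the structure
  map of an \<open>R'\<close>-algebra \<open>a\<close>, in order to regard algebras over
  \<open>fst a\<close> as algebras over \<open>R'\<close>.\<close>

locale base_change =
  fixes R R' :: "'u ring" and \<rho> :: "'u \<Rightarrow> 'u"
  assumes cring_R: "cring R" and cring_R': "cring R'"
    and \<rho>_hom: "\<rho> \<in> ring_hom R R'" and \<rho>_ext: "\<rho> \<in> extensional (carrier R)"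
begin

lemma ring_R: "ring R" and ring_R': "ring R'"
  using cring_R cring_R' by (simp_all add: cring.axioms(1))

lemma \<rho>_closed: "r \<in> carrier R \<Longrightarrow> \<rho> r \<in> carrier R'"
  using \<rho>_hom by (rule ring_hom_closed)

lemma restr_algs:
  assumes "a \<in> algs R'"
  shows "restr R \<rho> a \<in> algs R"
  using algsD[OF assms] ring_hom_compose[OF \<rho>_hom _ ring_R, of "snd a"]
  by (intro algsI) (simp_all add: restr_def)

lemma restr_restr: "restr R \<rho> (restr R' \<phi> c) = restr R (compose (carrier R) \<phi> \<rho>) c"
  by (auto simp: restr_def compose_def \<rho>_closed fun_eq_iff)

text \<open>Oriented so that the test algebras met after unfolding \<open>psh_base_change\<close>
  become those of \<open>F\<close> over \<open>restr R \<rho> a\<close>; statements over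
  \<open>R'\<close> then turn into literal instances of statements over \<open>R\<close>.\<close>

lemma restr_restr_alg: "restr R \<rho> (restr R' (snd a) c) = restr R (snd (restr R \<rho> a)) c"
  by (simp add: restr_restr) (simp add: restr_def)

lemma restr_alg_hom: "h \<in> alg_hom R' a b \<Longrightarrow> h \<in> alg_hom R (restr R \<rho> a) (restr R \<rho> b)"
  by (auto simp: alg_hom_def restr_def compose_def fun_eq_iff) (metis \<rho>_closed)

lemma restr_self_alg: "restr R \<rho> (self_alg R') = (R', \<rho>)"
  by (auto simp: restr_def self_alg_def intro!: compose_id_hom_left \<rho>_closed \<rho>_ext)

lemma R'_algs: "(R', \<rho>) \<in> algs R"
  by (simp add: algsI cring_R' \<rho>_hom \<rho>_ext)

lemma \<rho>_alg_hom: "\<rho> \<in> alg_hom R (self_alg R) (R', \<rho>)"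
  by (simp add: alg_hom_def self_alg_def \<rho>_hom \<rho>_ext compose_id_hom_right)

section \<open>Base change of presheaves and sheaves\<close>

lemma presheaf_base_change:
  assumes F: "presheaf R F"
  shows "presheaf R' (psh_base_change R \<rho> F)"
proof -
  note P = F[unfolded presheaf_def, THEN conjunct1]
    F[unfolded presheaf_def, THEN conjunct2, THEN conjunct1]
    F[unfolded presheaf_def, THEN conjunct2, THEN conjunct2]
  show ?thesis
    unfolding presheaf_def psh_base_change_def psh.simps
  proof (intro conjI ballI)
    show "res F (restr R \<rho> a) (restr R \<rho> b) h \<in> sec F (restr R \<rho> a) \<rightarrow> sec F (restr R \<rho> b)"
      if "a \<in> algs R'" "b \<in> algs R'" "h \<in> alg_hom R' a b" for a b h
      using P(1) that restr_algs restr_alg_hom by blast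
    show "res F (restr R \<rho> a) (restr R \<rho> a) (id_hom (fst a)) x = x"
      if "a \<in> algs R'" "x \<in> sec F (restr R \<rho> a)" for a x
      using P(2)[rule_format, OF restr_algs[OF that(1)] that(2)] by simp
    show "res F (restr R \<rho> a) (restr R \<rho> c) (compose (carrier (fst a)) k h) x =
        res F (restr R \<rho> b) (restr R \<rho> c) k (res F (restr R \<rho> a) (restr R \<rho> b) h x)"
      if "a \<in> algs R'" "b \<in> algs R'" "c \<in> algs R'" "h \<in> alg_hom R' a b" "k \<in> alg_hom R' b c"
        "x \<in> sec F (restr R \<rho> a)" for a b c h k x
      using P(3)[rule_format, OF restr_algs[OF that(1)] restr_algs[OF that(2)] restr_algs[OF that(3)]
          restr_alg_hom[OF that(4)] restr_alg_hom[OF that(5)] that(6)] by simp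
  qed
qed

text \<open>A covering depends only on the ring \<open>fst a\<close>, which restriction of scalars
  leaves alone, so a matching family over \<open>a\<close> is literally one over
  \<open>restr R \<rho> a\<close>. This works for any notion of covering.\<close>

lemma sheaf_base_change:
  assumes "sheaf covering R F"
  shows "sheaf covering R' (psh_base_change R \<rho> F)"
proof -
  have pre: "presheaf R F" and
    glue: "\<And>a C s. \<lbrakk>a \<in> algs R; covering (fst a) C; matching_family R F a C s\<rbrakk> \<Longrightarrow>
      \<exists>!x. x \<in> sec F a \<and> (\<forall>b\<in>C. res F a (restr R (snd a) b) (snd b) x = s b)"
    using assms by (auto simp: sheaf_def)
  have "presheaf R' (psh_base_change R \<rho> F)"
    using pre by (rule presheaf_base_change)
  moreover have "\<exists>!x. x \<in> sec (psh_base_change R \<rho> F) a \<and>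
      (\<forall>b\<in>C. res (psh_base_change R \<rho> F) a (restr R' (snd a) b) (snd b) x = s b)"
    if "a \<in> algs R'" "covering (fst a) C" "matching_family R' (psh_base_change R \<rho> F) a C s" for a C s
  proof -
    have "matching_family R F (restr R \<rho> a) C s"
      using that(3) unfolding matching_family_def psh_base_change_def psh.simps restr_restr_alg fst_restr .
    then have "\<exists>!x. x \<in> sec F (restr R \<rho> a) \<and>
        (\<forall>b\<in>C. res F (restr R \<rho> a) (restr R (snd (restr R \<rho> a)) b) (snd b) x = s b)"
      using glue restr_algs[OF that(1)] that(2) by simp
    then show ?thesis
      unfolding psh_base_change_def psh.simps restr_restr_alg .
  qed
  ultimately show ?thesis
    by (simp add: sheaf_def)
qed

end


section \<open>The tensor product with a base ring\<close>

text \<open>The tensor product of \<open>b\<close> with \<open>R'\<close> over \<open>R\<close> must have its carrier in \<open>'u\<close>. It is obtained as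
  the set of ring expressions in elements of \<open>R'\<close> and of \<open>b\<close>, two expressions being identified if
  they agree in every \<open>R'\<close>-algebra that receives a homomorphism from \<open>b\<close>. As \<open>'u\<close> is infinite,
  expressions can be coded by elements of \<open>'u\<close>.\<close>

datatype 'a expr = Scal 'a | Elem 'a | Plus "'a expr" "'a expr" | Times "'a expr" "'a expr" | Neg "'a expr"

text \<open>An infinite set is equinumerous with its square and contains a copy of the naturals. A
  pairing function and five distinct tags thus code the constructors injectively, by
  recursion.\<close>

lemma ex_inj_expr:
  assumes "infinite (UNIV :: 'a set)"
  shows "\<exists>f :: 'a expr \<Rightarrow> 'a. inj f"
proof -
  obtain p :: "'a \<times> 'a \<Rightarrow> 'a" where p: "inj p"
    using card_of_Times_same_infinite[OF assms] card_of_ordLeq[of "UNIV \<times> UNIV" UNIV]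
      ordIso_iff_ordLeq by (metis UNIV_Times_UNIV)
  obtain m :: "nat \<Rightarrow> 'a" where m: "inj m"
    using assms infinite_countable_subset by blast
  define f where "f = rec_expr (\<lambda>x. p (m 0, x)) (\<lambda>x. p (m 1, x))
    (\<lambda>_ _ x y. p (m 2, p (x, y))) (\<lambda>_ _ x y. p (m 3, p (x, y))) (\<lambda>_ x. p (m 4, x))"
  have "f s = f t \<Longrightarrow> s = t" for s t
    by (induction s arbitrary: t; case_tac t; simp add: f_def inj_eq[OF p] inj_eq[OF m])
  then show ?thesis
    by (auto simp: inj_def)
qed

text \<open>The only value that a homomorphism extending both \<open>snd c\<close> and
  \<open>h\<close> can take on the class of an expression.\<close>

primrec eval_expr :: "'u alg \<Rightarrow> ('u \<Rightarrow> 'u) \<Rightarrow> 'u expr \<Rightarrow> 'u" where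
  "eval_expr c h (Scal r) = snd c r"
| "eval_expr c h (Elem x) = h x"
| "eval_expr c h (Plus s t) = eval_expr c h s \<oplus>\<^bsub>fst c\<^esub> eval_expr c h t"
| "eval_expr c h (Times s t) = eval_expr c h s \<otimes>\<^bsub>fst c\<^esub> eval_expr c h t"
| "eval_expr c h (Neg t) = \<ominus>\<^bsub>fst c\<^esub> eval_expr c h t"

inductive_set exprs :: "'u set \<Rightarrow> 'u set \<Rightarrow> 'u expr set" for A B where
  Scal: "r \<in> A \<Longrightarrow> Scal r \<in> exprs A B"
| Elem: "x \<in> B \<Longrightarrow> Elem x \<in> exprs A B"
| Plus: "\<lbrakk>s \<in> exprs A B; t \<in> exprs A B\<rbrakk> \<Longrightarrow> Plus s t \<in> exprs A B"
| Times: "\<lbrakk>s \<in> exprs A B; t \<in> exprs A B\<rbrakk> \<Longrightarrow> Times s t \<in> exprs A B"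
| Neg: "t \<in> exprs A B \<Longrightarrow> Neg t \<in> exprs A B"

text \<open>The axioms are equations, to be checked after applying the jointly injective maps
  \<open>v i\<close>. The exception is the existence of additive inverses; as a ring record carries
  no negation, \<open>n\<close> supplies them.\<close>

lemma cring_if_jointly_injective:
  fixes B :: "('a, 'm) ring_scheme" and C :: "'i \<Rightarrow> ('b, 'n) ring_scheme"
  assumes cring: "\<And>i. i \<in> I \<Longrightarrow> cring (C i)"
    and val: "\<And>i x. \<lbrakk>i \<in> I; x \<in> carrier B\<rbrakk> \<Longrightarrow> v i x \<in> carrier (C i)"
    and inj: "\<And>x y. \<lbrakk>x \<in> carrier B; y \<in> carrier B; \<And>i. i \<in> I \<Longrightarrow> v i x = v i y\<rbrakk> \<Longrightarrow> x = y"
    and zero: "\<zero>\<^bsub>B\<^esub> \<in> carrier B" "\<And>i. i \<in> I \<Longrightarrow> v i \<zero>\<^bsub>B\<^esub> = \<zero>\<^bsub>C i\<^esub>"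
    and one: "\<one>\<^bsub>B\<^esub> \<in> carrier B" "\<And>i. i \<in> I \<Longrightarrow> v i \<one>\<^bsub>B\<^esub> = \<one>\<^bsub>C i\<^esub>"
    and add: "\<And>x y. \<lbrakk>x \<in> carrier B; y \<in> carrier B\<rbrakk> \<Longrightarrow> x \<oplus>\<^bsub>B\<^esub> y \<in> carrier B"
      "\<And>i x y. \<lbrakk>i \<in> I; x \<in> carrier B; y \<in> carrier B\<rbrakk> \<Longrightarrow> v i (x \<oplus>\<^bsub>B\<^esub> y) = v i x \<oplus>\<^bsub>C i\<^esub> v i y"
    and mult: "\<And>x y. \<lbrakk>x \<in> carrier B; y \<in> carrier B\<rbrakk> \<Longrightarrow> x \<otimes>\<^bsub>B\<^esub> y \<in> carrier B"
      "\<And>i x y. \<lbrakk>i \<in> I; x \<in> carrier B; y \<in> carrier B\<rbrakk> \<Longrightarrow> v i (x \<otimes>\<^bsub>B\<^esub> y) = v i x \<otimes>\<^bsub>C i\<^esub> v i y"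
    and neg: "\<And>x. x \<in> carrier B \<Longrightarrow> n x \<in> carrier B"
      "\<And>i x. \<lbrakk>i \<in> I; x \<in> carrier B\<rbrakk> \<Longrightarrow> v i (n x) = \<ominus>\<^bsub>C i\<^esub> v i x"
  shows "cring B"
proof (intro cringI abelian_groupI comm_monoidI)
  show "\<exists>y\<in>carrier B. y \<oplus>\<^bsub>B\<^esub> x = \<zero>\<^bsub>B\<^esub>" if "x \<in> carrier B" for x
    using that
    by (intro bexI[of _ "n x"] inj) (simp_all add: val zero add neg cring.cring_simprules[OF cring])
qed (auto intro!: inj simp: val zero one add mult cring.cring_simprules[OF cring])

text \<open>The identification of expressions makes the universal property nearly automatic: a pair
  \<open>(c, h)\<close> to be tested is itself one of the indices in \<open>I\<close>, and
  evaluation at it is the required homomorphism. Uniqueness and finite type hold because every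
  element comes from an expression, that is, from the images of \<open>R'\<close> and
  \<open>b\<close>.\<close>

lemma (in base_change) ex_tensor_product:
  assumes inf: "infinite (UNIV :: 'u set)" and b: "b \<in> algs R"
  obtains b' \<iota> where "b' \<in> algs R'" "\<iota> \<in> alg_hom R b (restr R \<rho> b')"
    "\<And>c. c \<in> algs R' \<Longrightarrow> bij_betw (\<lambda>g. compose (carrier (fst b)) g \<iota>)
       (alg_hom R' b' c) (alg_hom R b (restr R \<rho> c))"
    "finite_type_alg R b \<Longrightarrow> finite_type_alg R' b'"
proof -
  obtain code :: "'u expr \<Rightarrow> 'u" where code: "inj code"
    using ex_inj_expr[OF inf] by blast
  define E where "E = exprs (carrier R') (carrier (fst b))"
  define I where "I = {(c, h). c \<in> algs R' \<and> h \<in> alg_hom R b (restr R \<rho> c)}"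
  define eq where "eq s t \<longleftrightarrow> (\<forall>i\<in>I. eval_expr (fst i) (snd i) s = eval_expr (fst i) (snd i) t)" for s t
  \<comment> \<open>A class is represented by one chosen member instead of the set of its members,
    since single expressions are what can be coded in \<open>'u\<close>.\<close>
  define rep where "rep t = (SOME s. s \<in> E \<and> eq s t)" for t
  define nf where "nf t = code (rep t)" for t
  define dc where "dc = inv_into UNIV code"
  define B where "B = \<lparr>carrier = nf ` E, monoid.mult = \<lambda>x y. nf (Times (dc x) (dc y)),
    one = nf (Scal \<one>\<^bsub>R'\<^esub>), zero = nf (Scal \<zero>\<^bsub>R'\<^esub>), add = \<lambda>x y. nf (Plus (dc x) (dc y))\<rparr>"
  define v where "v i x = eval_expr (fst i) (snd i) (dc x)" for i x
  define \<beta> where "\<beta> = (\<lambda>r\<in>carrier R'. nf (Scal r))"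
  define \<iota> where "\<iota> = (\<lambda>x\<in>carrier (fst b). nf (Elem x))"

  \<comment> \<open>The ring structure on codes of representatives\<close>
  have ring_b: "ring (fst b)"
    using algsD(1)[OF b] by (rule cring.axioms(1))
  note R'_closed = ring.ring_simprules(1,2,5,6)[OF ring_R']
    and b_ops = ring.ring_simprules(1,2,5,6)[OF ring_b]
  note Scal = exprs.Scal[of _ "carrier R'" "carrier (fst b)", folded E_def]
    and Elem = exprs.Elem[of _ "carrier (fst b)" "carrier R'", folded E_def]
    and Plus = exprs.Plus[of _ "carrier R'" "carrier (fst b)", folded E_def]
    and Times = exprs.Times[of _ "carrier R'" "carrier (fst b)", folded E_def]
    and Neg = exprs.Neg[of _ "carrier R'" "carrier (fst b)", folded E_def]
  have I_cring: "cring (fst (fst i))" and I_alg: "fst i \<in> algs R'"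
    and I_hom: "snd i \<in> alg_hom R b (restr R \<rho> (fst i))" if "i \<in> I" for i
    using that algsD by (auto simp: I_def)
  have I_scal: "snd (fst i) \<in> ring_hom R' (fst (fst i))" if "i \<in> I" for i
    using I_alg[OF that] algsD by blast
  have I_elem: "snd i \<in> ring_hom (fst b) (fst (fst i))" if "i \<in> I" for i
    using I_hom[OF that] by (simp add: alg_hom_def)
  have rep: "rep t \<in> E" "eq (rep t) t" if "t \<in> E" for t
    using someI[of "\<lambda>s. s \<in> E \<and> eq s t" t] that by (auto simp: rep_def eq_def)
  have rep_cong: "rep s = rep t" if "eq s t" for s t
    using that by (simp add: rep_def eq_def)
  have dc_nf: "dc (nf t) = rep t" for t
    using code by (simp add: dc_def nf_def)
  \<comment> \<open>\<open>dc (nf t)\<close> is only a representative of the class of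
    \<open>t\<close>, but evaluation at a pair in \<open>I\<close> cannot tell it from
    \<open>t\<close>.\<close>
  have v_nf [simp]: "v i (nf t) = eval_expr (fst i) (snd i) t" if "i \<in> I" "t \<in> E" for i t
    using rep(2)[OF that(2)] that(1) by (auto simp: v_def dc_nf eq_def)
  have dc_E: "dc x \<in> E" if "x \<in> carrier B" for x
    using that rep(1) by (auto simp: B_def dc_nf)
  have nf_B: "nf t \<in> carrier B" if "t \<in> E" for t
    using that by (simp add: B_def)
  have eval_closed: "eval_expr (fst i) (snd i) t \<in> carrier (fst (fst i))" if "i \<in> I" "t \<in> E" for i t
    using that(2) unfolding E_def
  proof induction
    case (Scal r)
    then show ?case using I_scal[OF that(1)] by (simp add: ring_hom_closed)
  next
    case (Elem x)
    then show ?case using I_elem[OF that(1)] by (simp add: ring_hom_closed)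
  qed (use cring.cring_simprules[OF I_cring[OF that(1)]] in auto)
  have v_closed: "v i x \<in> carrier (fst (fst i))" if "i \<in> I" "x \<in> carrier B" for i x
    using that eval_closed dc_E by (simp add: v_def)
  \<comment> \<open>From here on, identities in \<open>B\<close> are proved by evaluating both sides
    at all pairs in \<open>I\<close>.\<close>
  have v_inj: "x = y" if "x \<in> carrier B" "y \<in> carrier B" "\<And>i. i \<in> I \<Longrightarrow> v i x = v i y" for x y
  proof -
    obtain s t where st: "s \<in> E" "t \<in> E" "x = nf s" "y = nf t"
      using \<open>x \<in> carrier B\<close> \<open>y \<in> carrier B\<close> by (auto simp: B_def)
    then have "eval_expr (fst i) (snd i) s = eval_expr (fst i) (snd i) t" if "i \<in> I" for i
      using \<open>\<And>i. i \<in> I \<Longrightarrow> v i x = v i y\<close>[OF that] v_nf[OF that] by simp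
    then have "eq s t" by (simp add: eq_def)
    then show "x = y" using st rep_cong by (simp add: nf_def)
  qed
  have zero_B: "\<zero>\<^bsub>B\<^esub> \<in> carrier B" and one_B: "\<one>\<^bsub>B\<^esub> \<in> carrier B"
    using nf_B[OF Scal] R'_closed by (auto simp: B_def)
  have v_zero: "v i \<zero>\<^bsub>B\<^esub> = \<zero>\<^bsub>fst (fst i)\<^esub>" if "i \<in> I" for i
    using that ring_hom_zero[OF I_scal ring_R' cring.axioms(1)[OF I_cring]]
    by (simp add: B_def Scal R'_closed)
  have v_one: "v i \<one>\<^bsub>B\<^esub> = \<one>\<^bsub>fst (fst i)\<^esub>" if "i \<in> I" for i
    using that ring_hom_one[OF I_scal] by (simp add: B_def Scal R'_closed)
  have add_B: "x \<oplus>\<^bsub>B\<^esub> y \<in> carrier B" and mult_B: "x \<otimes>\<^bsub>B\<^esub> y \<in> carrier B"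
    if "x \<in> carrier B" "y \<in> carrier B" for x y
    using that nf_B[OF Plus] nf_B[OF Times] dc_E by (auto simp: B_def)
  have v_add: "v i (x \<oplus>\<^bsub>B\<^esub> y) = v i x \<oplus>\<^bsub>fst (fst i)\<^esub> v i y"
    and v_mult: "v i (x \<otimes>\<^bsub>B\<^esub> y) = v i x \<otimes>\<^bsub>fst (fst i)\<^esub> v i y"
    if "i \<in> I" "x \<in> carrier B" "y \<in> carrier B" for i x y
    using v_nf[OF that(1) Plus[OF dc_E[OF that(2)] dc_E[OF that(3)]]]
      v_nf[OF that(1) Times[OF dc_E[OF that(2)] dc_E[OF that(3)]]]
    by (simp_all add: B_def v_def)
  have neg_B: "nf (Neg (dc x)) \<in> carrier B" if "x \<in> carrier B" for x
    using that nf_B[OF Neg] dc_E by auto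
  have v_neg: "v i (nf (Neg (dc x))) = \<ominus>\<^bsub>fst (fst i)\<^esub> v i x" if "i \<in> I" "x \<in> carrier B" for i x
    using v_nf[OF that(1) Neg[OF dc_E[OF that(2)]]] by (simp add: v_def)
  have cring_B: "cring B"
    by (rule cring_if_jointly_injective[where I = I and C = "\<lambda>i. fst (fst i)" and v = v
          and n = "\<lambda>x. nf (Neg (dc x))"])
      (fact I_cring v_closed v_inj zero_B v_zero one_B v_one add_B v_add mult_B v_mult neg_B v_neg)+
  then have ring_B: "ring B" by (rule cring.axioms(1))

  \<comment> \<open>The maps from \<open>R'\<close> and from \<open>b\<close> to the tensor
    product\<close>
  have \<beta>_hom: "\<beta> \<in> ring_hom R' B"
  proof (rule ring_hom_memI)
    show "\<beta> \<one>\<^bsub>R'\<^esub> = \<one>\<^bsub>B\<^esub>"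
      by (simp add: \<beta>_def B_def R'_closed)
    show "\<beta> x \<in> carrier B" if "x \<in> carrier R'" for x
      using that by (simp add: \<beta>_def nf_B Scal)
    fix x y assume xy: "x \<in> carrier R'" "y \<in> carrier R'"
    then show "\<beta> (x \<otimes>\<^bsub>R'\<^esub> y) = \<beta> x \<otimes>\<^bsub>B\<^esub> \<beta> y" "\<beta> (x \<oplus>\<^bsub>R'\<^esub> y) = \<beta> x \<oplus>\<^bsub>B\<^esub> \<beta> y"
      by - ((rule v_inj; simp add: mult_B add_B \<beta>_def nf_B Scal R'_closed v_mult v_add
          ring_hom_mult[OF I_scal] ring_hom_add[OF I_scal])+)
  qed
  have \<iota>_hom: "\<iota> \<in> ring_hom (fst b) B"
  proof (rule ring_hom_memI)
    show "\<iota> x \<in> carrier B" if "x \<in> carrier (fst b)" for x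
      using that by (simp add: \<iota>_def nf_B Elem)
    show "\<iota> \<one>\<^bsub>fst b\<^esub> = \<one>\<^bsub>B\<^esub>"
      by (rule v_inj; simp add: one_B \<iota>_def nf_B Elem b_ops v_one ring_hom_one[OF I_elem])
    fix x y assume xy: "x \<in> carrier (fst b)" "y \<in> carrier (fst b)"
    then show "\<iota> (x \<otimes>\<^bsub>fst b\<^esub> y) = \<iota> x \<otimes>\<^bsub>B\<^esub> \<iota> y" "\<iota> (x \<oplus>\<^bsub>fst b\<^esub> y) = \<iota> x \<oplus>\<^bsub>B\<^esub> \<iota> y"
      by - ((rule v_inj; simp add: mult_B add_B \<iota>_def nf_B Elem b_ops v_mult v_add
          ring_hom_mult[OF I_elem] ring_hom_add[OF I_elem])+)
  qed
  have b'_alg: "(B, \<beta>) \<in> algs R'"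
    using cring_B \<beta>_hom by (auto intro!: algsI simp: \<beta>_def)
  have b_closed: "snd b r \<in> carrier (fst b)" if "r \<in> carrier R" for r
    using algsD(2)[OF b] that by (rule ring_hom_closed)
  \<comment> \<open>The relation between the two kinds of scalars. It holds because every
    \<open>h\<close> in \<open>I\<close> is \<open>R\<close>-linear.\<close>
  have \<iota>_scal: "\<iota> (snd b r) = \<beta> (\<rho> r)" if "r \<in> carrier R" for r
  proof (rule v_inj)
    fix i assume i: "i \<in> I"
    have "snd i (snd b r) = compose (carrier R) (snd i) (snd b) r"
      using that by (simp add: compose_def)
    also have "\<dots> = snd (fst i) (\<rho> r)"
      using I_hom[OF i] that by (simp add: alg_hom_def restr_def compose_def)
    finally show "v i (\<iota> (snd b r)) = v i (\<beta> (\<rho> r))"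
      using that i by (simp add: \<iota>_def \<beta>_def b_closed \<rho>_closed Scal Elem)
  qed (use that ring_hom_closed[OF \<iota>_hom] ring_hom_closed[OF \<beta>_hom] b_closed \<rho>_closed in auto)
  have \<iota>_alg: "\<iota> \<in> alg_hom R b (restr R \<rho> (B, \<beta>))"
    using \<iota>_hom by (auto simp: alg_hom_def restr_def \<iota>_scal compose_def fun_eq_iff) (auto simp: \<iota>_def)
  \<comment> \<open>The operations of \<open>B\<close> are defined on chosen representatives. That
    they may be computed on arbitrary expressions is what allows the inductions over
    \<open>exprs\<close> below.\<close>
  have nf_Plus: "nf (Plus s t) = nf s \<oplus>\<^bsub>B\<^esub> nf t" and nf_Times: "nf (Times s t) = nf s \<otimes>\<^bsub>B\<^esub> nf t"
    if "s \<in> E" "t \<in> E" for s t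
    using that by - ((rule v_inj; simp add: add_B mult_B nf_B Plus Times v_add v_mult)+)
  \<comment> \<open>Negation is not a field of \<open>B\<close>, so it is recognized by the
    uniqueness of additive inverses.\<close>
  have nf_Neg: "nf (Neg t) = \<ominus>\<^bsub>B\<^esub> nf t" if "t \<in> E" for t
  proof -
    have "nf (Neg t) \<oplus>\<^bsub>B\<^esub> nf t = \<zero>\<^bsub>B\<^esub>"
      using that by - (rule v_inj; simp add: add_B zero_B nf_B Neg v_add v_zero eval_closed
          cring.cring_simprules(9)[OF I_cring])
    then show ?thesis
      using abelian_group.minus_equality[OF ring.is_abelian_group[OF ring_B]] that nf_B Neg by metis
  qed

  \<comment> \<open>The universal property\<close>
  have bij: "bij_betw (\<lambda>g. compose (carrier (fst b)) g \<iota>)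
      (alg_hom R' (B, \<beta>) c) (alg_hom R b (restr R \<rho> c))" if c: "c \<in> algs R'" for c
  proof (rule bij_betwI)
    \<comment> \<open>The inverse of the bijection: \<open>(c, h)\<close> belongs to
      \<open>I\<close>, and \<open>B\<close> is evaluated there.\<close>
    let ?\<iota>' = "\<lambda>h. \<lambda>x\<in>carrier B. v (c, h) x"
    have restr_v: "?\<iota>' h \<in> alg_hom R' (B, \<beta>) c"
      and ext: "compose (carrier (fst b)) (?\<iota>' h) \<iota> = h" if "h \<in> alg_hom R b (restr R \<rho> c)" for h
    proof -
      have i: "(c, h) \<in> I" using c that by (simp add: I_def)
      have "?\<iota>' h \<in> ring_hom B (fst c)"
        using v_closed[OF i] v_add[OF i] v_mult[OF i] v_one[OF i] add_B mult_B one_B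
        by (auto intro!: ring_hom_memI)
      moreover have "compose (carrier R') (?\<iota>' h) \<beta> = snd c"
        using algsD(3)[OF c] i
        by (auto simp: compose_def fun_eq_iff \<beta>_def nf_B Scal extensional_def)
      ultimately show "?\<iota>' h \<in> alg_hom R' (B, \<beta>) c"
        by (simp add: alg_hom_def)
      show "compose (carrier (fst b)) (?\<iota>' h) \<iota> = h"
        using that i by (auto simp: compose_def fun_eq_iff \<iota>_def nf_B Elem extensional_def alg_hom_def)
    qed
    then show "?\<iota>' \<in> alg_hom R b (restr R \<rho> c) \<rightarrow> alg_hom R' (B, \<beta>) c" by blast
    show "\<And>h. h \<in> alg_hom R b (restr R \<rho> c) \<Longrightarrow> compose (carrier (fst b)) (?\<iota>' h) \<iota> = h"
      by (fact ext)
    have comp: "compose (carrier (fst b)) g \<iota> \<in> alg_hom R b (restr R \<rho> c)"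
      if "g \<in> alg_hom R' (B, \<beta>) c" for g
    proof -
      have "g \<in> ring_hom B (fst c)" using that by (simp add: alg_hom_def)
      moreover have "g (\<beta> r) = snd c r" if "r \<in> carrier R'" for r
        using \<open>g \<in> alg_hom R' (B, \<beta>) c\<close> that
        by (simp add: alg_hom_def compose_def fun_eq_iff) metis
      ultimately show ?thesis
        using ring_hom_compose[OF \<iota>_hom _ ring_b, of g] \<iota>_scal b_closed \<rho>_closed
        by (auto simp: alg_hom_def restr_def compose_def fun_eq_iff)
    qed
    then show "(\<lambda>g. compose (carrier (fst b)) g \<iota>) \<in> alg_hom R' (B, \<beta>) c \<rightarrow> alg_hom R b (restr R \<rho> c)"
      by blast
    show "?\<iota>' (compose (carrier (fst b)) g \<iota>) = g" if g: "g \<in> alg_hom R' (B, \<beta>) c" for g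
    proof -
      let ?h = "compose (carrier (fst b)) g \<iota>"
      have i: "(c, ?h) \<in> I" using c comp[OF g] by (simp add: I_def)
      have g_hom: "g \<in> ring_hom B (fst c)" using g by (simp add: alg_hom_def)
      interpret g: ring_hom_ring B "fst c" g
        using ring_B cring.axioms(1)[OF algsD(1)[OF c]] g_hom by (rule ring_hom_ringI2)
      \<comment> \<open>Uniqueness: by induction on expressions, \<open>g\<close> is the evaluation
        at the pair that it induces.\<close>
      have "g (nf t) = eval_expr c ?h t" if "t \<in> E" for t
        using that unfolding E_def
      proof induction
        case (Scal r)
        then have "g (\<beta> r) = snd c r"
          using g by (simp add: alg_hom_def compose_def fun_eq_iff) metis
        then show ?case using Scal by (simp add: \<beta>_def)
      next
        case (Elem x)
        then show ?case by (simp add: compose_def \<iota>_def)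
      qed (simp_all add: E_def[symmetric] nf_Plus nf_Times nf_Neg nf_B g.hom_add g.hom_mult g.hom_a_inv)
      then have "v (c, ?h) x = g x" if "x \<in> carrier B" for x
        using that v_nf[OF i] by (auto simp: B_def)
      then show ?thesis
        using g by (auto simp: alg_hom_def extensional_def fun_eq_iff)
    qed
  qed

  \<comment> \<open>Finite type\<close>
  have "finite_type_alg R' (B, \<beta>)" if fin: "finite_type_alg R b"
  proof -
    obtain S where S: "finite S" "S \<subseteq> carrier (fst b)"
      "generate_ring (fst b) (snd b ` carrier R \<union> S) = carrier (fst b)"
      using fin by (auto simp: finite_type_alg_def)
    \<comment> \<open>The images of the generators of \<open>b\<close> suffice: scalars from
      \<open>R\<close> pass into the image of \<open>R'\<close> by
      \<open>\<iota>_scal\<close>.\<close>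
    let ?H = "\<beta> ` carrier R' \<union> \<iota> ` S"
    interpret \<iota>: ring_hom_ring "fst b" B \<iota>
      using ring_b ring_B \<iota>_hom by (rule ring_hom_ringI2)
    have H: "?H \<subseteq> carrier B"
      using S(2) ring_hom_closed[OF \<iota>_hom] ring_hom_closed[OF \<beta>_hom] by auto
    have \<iota>_gen: "\<iota> x \<in> generate_ring B ?H" if "x \<in> carrier (fst b)" for x
      using that unfolding S(3)[symmetric]
    proof induction
      case one
      then show ?case using generate_ring.one[of B ?H] by simp
    next
      case (incl h)
      then show ?case using \<iota>_scal \<rho>_closed by (auto intro!: generate_ring.incl)
    next
      case (a_inv h)
      then show ?case using S(3) by (simp add: generate_ring.a_inv)
    next
      case (eng_add h h')
      then show ?case using S(3) by (simp add: generate_ring.eng_add)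
    next
      case (eng_mult h h')
      then show ?case using S(3) by (simp add: generate_ring.eng_mult)
    qed
    have "nf t \<in> generate_ring B ?H" if "t \<in> E" for t
      using that unfolding E_def
    proof induction
      case (Scal r)
      then show ?case using generate_ring.incl[of "\<beta> r" ?H B] by (simp add: \<beta>_def)
    next
      case (Elem x)
      then show ?case using \<iota>_gen[of x] by (simp add: \<iota>_def)
    qed (simp_all add: E_def[symmetric] nf_Plus nf_Times nf_Neg generate_ring.intros)
    then have "generate_ring B ?H = carrier B"
      using ring.generate_ring_incl[OF ring_B H] by (auto simp: B_def)
    then show ?thesis
      using S H unfolding finite_type_alg_def by (intro exI[of _ "\<iota> ` S"]) auto
  qed
  then show thesis
    using that[OF b'_alg \<iota>_alg bij] by blast
qed


section \<open>Base change of schemes of finite type\<close>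

text \<open>An open immersion is defined by which of its fibres are singletons and which are empty,
  so a bijection between fibres transports the definition.\<close>

lemma bij_betw_ex1:
  assumes "bij_betw f A B"
  shows "(\<exists>!x. x \<in> A) \<longleftrightarrow> (\<exists>!y. y \<in> B)"
proof -
  have "(\<exists>!x. x \<in> A) \<longleftrightarrow> card A = 1" "(\<exists>!y. y \<in> B) \<longleftrightarrow> card B = 1"
    by (auto simp: card_1_singleton_iff)
  then show ?thesis
    using bij_betw_same_card[OF assms] by simp
qed

lemma bij_betw_empty_iff: "bij_betw f A B \<Longrightarrow> A = {} \<longleftrightarrow> B = {}"
  by (auto simp: bij_betw_def)

context base_change
begin

text \<open>By functoriality of \<open>F\<close>, the charts \<open>Spec b'\<close> and
  \<open>Spec b\<close> have the same morphism to \<open>F\<close> once their points are identified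
  by the universal property, \<open>g\<close> with its composite with
  \<open>\<iota>\<close>.\<close>

lemma yoneda_base_change:
  assumes F: "presheaf R F" and b: "b \<in> algs R" and \<xi>: "\<xi> \<in> sec F b" and b': "b' \<in> algs R'"
    and \<iota>: "\<iota> \<in> alg_hom R b (restr R \<rho> b')" and c: "c \<in> algs R'" and g: "g \<in> alg_hom R' b' c"
  shows "yoneda (psh_base_change R \<rho> F) b' (res F b (restr R \<rho> b') \<iota> \<xi>) c g =
    yoneda F b \<xi> (restr R \<rho> c) (compose (carrier (fst b)) g \<iota>)"
  using F b restr_algs[OF b'] restr_algs[OF c] \<iota> restr_alg_hom[OF g] \<xi>
  unfolding yoneda_def psh_base_change_def presheaf_def by simp

text \<open>The universal property restricts to a bijection from each fibre over \<open>a\<close> to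
  the corresponding fibre over \<open>restr R \<rho> a\<close>. Both have the base ring
  \<open>fst a\<close>, so the same ideal describes the open subset.\<close>

lemma open_immersion_base_change:
  assumes F: "presheaf R F" and b: "b \<in> algs R" and \<xi>: "\<xi> \<in> sec F b" and b': "b' \<in> algs R'"
    and \<iota>: "\<iota> \<in> alg_hom R b (restr R \<rho> b')"
    and univ: "\<And>c. c \<in> algs R' \<Longrightarrow> bij_betw (\<lambda>g. compose (carrier (fst b)) g \<iota>)
       (alg_hom R' b' c) (alg_hom R b (restr R \<rho> c))"
    and im: "open_immersion R (spec R b) F (yoneda F b \<xi>)"
  shows "open_immersion R' (spec R' b') (psh_base_change R \<rho> F)
    (yoneda (psh_base_change R \<rho> F) b' (res F b (restr R \<rho> b') \<iota> \<xi>))"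
proof -
  let ?F' = "psh_base_change R \<rho> F" and ?\<xi>' = "res F b (restr R \<rho> b') \<iota> \<xi>"
  have F': "presheaf R' ?F'"
    using F by (rule presheaf_base_change)
  have \<xi>': "?\<xi>' \<in> sec ?F' b'"
    using presheaf_res_closed[OF F b restr_algs[OF b'] \<iota> \<xi>] by (simp add: psh_base_change_def)
  have "psh_hom R' (spec R' b') ?F' (yoneda ?F' b' ?\<xi>')"
    using F' \<xi>' b' unfolding psh_hom_def spec_def yoneda_def presheaf_def
    by (auto; blast)
  moreover have "\<exists>J. ideal J (fst a) \<and> (\<forall>c\<in>algs (fst a).
        if Idl\<^bsub>fst c\<^esub> (snd c ` J) = carrier (fst c)
        then \<exists>!x. x \<in> sec (psh_fibre R' (spec R' b') ?F' (yoneda ?F' b' ?\<xi>') a y) c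
        else sec (psh_fibre R' (spec R' b') ?F' (yoneda ?F' b' ?\<xi>') a y) c = {})"
    if a: "a \<in> algs R'" and y: "y \<in> sec ?F' a" for a y
  proof -
    let ?P = "psh_fibre R (spec R b) F (yoneda F b \<xi>) (restr R \<rho> a) y"
    have "y \<in> sec F (restr R \<rho> a)"
      using y by (simp add: psh_base_change_def)
    then obtain J where J: "ideal J (fst a)" "\<And>c. c \<in> algs (fst a) \<Longrightarrow>
        if Idl\<^bsub>fst c\<^esub> (snd c ` J) = carrier (fst c)
        then \<exists>!x. x \<in> sec ?P c else sec ?P c = {}"
      using im restr_algs[OF a] unfolding open_immersion_def by (metis fst_restr)
    have "bij_betw (\<lambda>g. compose (carrier (fst b)) g \<iota>)
        (sec (psh_fibre R' (spec R' b') ?F' (yoneda ?F' b' ?\<xi>') a y) c) (sec ?P c)"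
      if c: "c \<in> algs (fst a)" for c
    proof -
      interpret a: base_change R' "fst a" "snd a"
        using cring_R' algsD[OF a] by (intro base_change.intro)
      let ?c = "restr R' (snd a) c"
      have c': "?c \<in> algs R'" by (rule a.restr_algs[OF c])
      \<comment> \<open>The condition cutting the fibre out of \<open>Spec b\<close>; through
        \<open>\<iota>\<close> it also cuts out the fibre of \<open>Spec b'\<close>.\<close>
      let ?Q = "\<lambda>h. yoneda F b \<xi> (restr R \<rho> ?c) h = res F (restr R \<rho> a) (restr R \<rho> ?c) (snd c) y"
      have "bij_betw (\<lambda>g. compose (carrier (fst b)) g \<iota>)
          {g \<in> alg_hom R' b' ?c. ?Q (compose (carrier (fst b)) g \<iota>)} {h \<in> alg_hom R b (restr R \<rho> ?c). ?Q h}"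
        using univ[OF c'] by (fastforce simp: bij_betw_def inj_on_def)
      moreover have "sec (psh_fibre R' (spec R' b') ?F' (yoneda ?F' b' ?\<xi>') a y) c =
          {g \<in> alg_hom R' b' ?c. ?Q (compose (carrier (fst b)) g \<iota>)}"
        using yoneda_base_change[OF F b \<xi> b' \<iota> c']
        by (auto simp: psh_fibre_def spec_def) (auto simp: psh_base_change_def)
      moreover have "sec ?P c = {h \<in> alg_hom R b (restr R \<rho> ?c). ?Q h}"
        by (simp add: psh_fibre_def spec_def restr_restr_alg)
      ultimately show ?thesis by simp
    qed
    note transfer = bij_betw_ex1[OF this] bij_betw_empty_iff[OF this]
    show ?thesis
    proof (intro exI[of _ J] conjI ballI)
      fix c assume c: "c \<in> algs (fst a)"
      show "if Idl\<^bsub>fst c\<^esub> (snd c ` J) = carrier (fst c)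
          then \<exists>!x. x \<in> sec (psh_fibre R' (spec R' b') ?F' (yoneda ?F' b' ?\<xi>') a y) c
          else sec (psh_fibre R' (spec R' b') ?F' (yoneda ?F' b' ?\<xi>') a y) c = {}"
        unfolding transfer[OF c] by (rule J(2)[OF c])
    qed (fact J(1))
  qed
  ultimately show ?thesis
    by (simp add: open_immersion_def)
qed

text \<open>Each chart is replaced by its tensor product with \<open>R'\<close>. The new charts
  still cover, because a point of the base change in a field is a point of \<open>F\<close> in that
  field, and a lift of it to an old chart extends to the new one.\<close>

theorem finite_type_scheme_base_change:
  assumes inf: "infinite (UNIV :: 'u set)" and F: "finite_type_scheme R F"
  shows "finite_type_scheme R' (psh_base_change R \<rho> F)"
proof -
  let ?F' = "psh_base_change R \<rho> F"
  obtain U where sh: "sheaf zariski_cover R F" and U: "finite U" "open_affine_cover R F U"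
    and ft: "\<And>b \<xi>. (b, \<xi>) \<in> U \<Longrightarrow> finite_type_alg R b"
    using F unfolding finite_type_scheme_def by fast
  have pre: "presheaf R F" using sh by (simp add: sheaf_def)
  have aff: "b \<in> algs R" "\<xi> \<in> sec F b" "open_immersion R (spec R b) F (yoneda F b \<xi>)"
    if "(b, \<xi>) \<in> U" for b \<xi>
    using U(2) that by (auto simp: open_affine_cover_def)
  have "\<exists>b' \<iota>. b' \<in> algs R' \<and> \<iota> \<in> alg_hom R b (restr R \<rho> b') \<and>
      (\<forall>c\<in>algs R'. bij_betw (\<lambda>g. compose (carrier (fst b)) g \<iota>)
         (alg_hom R' b' c) (alg_hom R b (restr R \<rho> c))) \<and>
      (finite_type_alg R b \<longrightarrow> finite_type_alg R' b')" if "b \<in> algs R" for b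
    using ex_tensor_product[OF inf that] by metis
  then obtain t \<iota> where t: "\<And>b. b \<in> algs R \<Longrightarrow> t b \<in> algs R'"
    and \<iota>: "\<And>b. b \<in> algs R \<Longrightarrow> \<iota> b \<in> alg_hom R b (restr R \<rho> (t b))"
    and univ: "\<And>b c. \<lbrakk>b \<in> algs R; c \<in> algs R'\<rbrakk> \<Longrightarrow> bij_betw (\<lambda>g. compose (carrier (fst b)) g (\<iota> b))
         (alg_hom R' (t b) c) (alg_hom R b (restr R \<rho> c))"
    and ft_t: "\<And>b. \<lbrakk>b \<in> algs R; finite_type_alg R b\<rbrakk> \<Longrightarrow> finite_type_alg R' (t b)"
    by metis
  define bc where "bc = (\<lambda>(b, \<xi>). (t b, res F b (restr R \<rho> (t b)) (\<iota> b) \<xi>))"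
  have "family_surjective R' ?F' (bc ` U)"
    unfolding family_surjective_def
  proof (intro ballI impI)
    fix k y assume k: "k \<in> algs R'" "Ring.field (fst k)" and y: "y \<in> sec ?F' k"
    have "y \<in> sec F (restr R \<rho> k)" using y by (simp add: psh_base_change_def)
    then obtain K b \<xi> g where K: "K \<in> algs (fst k)" "Ring.field (fst K)" and b\<xi>: "(b, \<xi>) \<in> U"
      and g: "g \<in> alg_hom R b (restr R (snd (restr R \<rho> k)) K)"
      and eq: "yoneda F b \<xi> (restr R (snd (restr R \<rho> k)) K) g =
        res F (restr R \<rho> k) (restr R (snd (restr R \<rho> k)) K) (snd K) y"
      using U(2) restr_algs[OF k(1)] k(2) unfolding open_affine_cover_def family_surjective_def
      by (fastforce split: prod.splits)
    interpret k: base_change R' "fst k" "snd k"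
      using cring_R' algsD[OF k(1)] by (intro base_change.intro)
    have K': "restr R' (snd k) K \<in> algs R'" by (rule k.restr_algs[OF K(1)])
    have b: "b \<in> algs R" "\<xi> \<in> sec F b" using aff[OF b\<xi>] by auto
    \<comment> \<open>\<open>K\<close> is an \<open>R'\<close>-algebra through \<open>k\<close>, so
      the universal property applies to \<open>g\<close>.\<close>
    obtain g' where g': "g' \<in> alg_hom R' (t b) (restr R' (snd k) K)"
      "g = compose (carrier (fst b)) g' (\<iota> b)"
      using univ[OF b(1) K'] g by (auto simp: bij_betw_def restr_restr_alg)
    have "yoneda ?F' (t b) (res F b (restr R \<rho> (t b)) (\<iota> b) \<xi>) (restr R' (snd k) K) g' =
        res ?F' k (restr R' (snd k) K) (snd K) y"
      using yoneda_base_change[OF pre b t[OF b(1)] \<iota>[OF b(1)] K' g'(1)] eq g'(2)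
      by (simp add: restr_restr_alg) (simp add: psh_base_change_def restr_restr_alg)
    then show "\<exists>K\<in>algs (fst k). Ring.field (fst K) \<and> (\<exists>(b, \<xi>)\<in>bc ` U.
        \<exists>g\<in>alg_hom R' b (restr R' (snd k) K).
          yoneda ?F' b \<xi> (restr R' (snd k) K) g = res ?F' k (restr R' (snd k) K) (snd K) y)"
      using K g'(1) b\<xi> by (intro bexI[of _ K]) (force simp: bc_def)+
  qed
  moreover have "b' \<in> algs R' \<and> \<xi>' \<in> sec ?F' b' \<and> open_immersion R' (spec R' b') ?F' (yoneda ?F' b' \<xi>') \<and>
      finite_type_alg R' b'" if b'\<xi>': "(b', \<xi>') \<in> bc ` U" for b' \<xi>'
  proof -
    obtain b \<xi> where b\<xi>: "(b, \<xi>) \<in> U" "b' = t b" "\<xi>' = res F b (restr R \<rho> (t b)) (\<iota> b) \<xi>"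
      using b'\<xi>' by (auto simp: bc_def)
    note b = aff[OF b\<xi>(1)]
    have "\<xi>' \<in> sec ?F' b'"
      using presheaf_res_closed[OF pre b(1) restr_algs[OF t] \<iota> b(2)] b(1) b\<xi>(2,3)
      by (simp add: psh_base_change_def)
    then show ?thesis
      using open_immersion_base_change[OF pre b(1,2) t \<iota> univ b(3)] b(1) t ft_t ft[OF b\<xi>(1)] b\<xi>(2,3)
      by simp
  qed
  ultimately have "open_affine_cover R' ?F' (bc ` U) \<and> (\<forall>(b, \<xi>)\<in>bc ` U. finite_type_alg R' b)"
    unfolding open_affine_cover_def by blast
  then show ?thesis
    using sheaf_base_change[OF sh] U(1) unfolding finite_type_scheme_def by blast
qed

end


section \<open>Base change of stacks\<close>

context base_change
begin

text \<open>An object of the base change must remember its \<open>R'\<close>-algebra, of which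
  \<open>X\<close> sees only the restriction to \<open>R\<close>. Arrows carry no additional
  data.\<close>

definition bc_fo :: "('u alg \<Rightarrow> 'z \<Rightarrow> 'o) \<Rightarrow> 'u alg \<Rightarrow> 'z \<Rightarrow> 'o \<times> 'u alg" where
  "bc_fo fo = (\<lambda>a z. (fo (restr R \<rho> a) z, a))"

definition bc_fm :: "('u alg \<Rightarrow> 'u alg \<Rightarrow> ('u \<Rightarrow> 'u) \<Rightarrow> 'z \<Rightarrow> 'm) \<Rightarrow>
    'u alg \<Rightarrow> 'u alg \<Rightarrow> ('u \<Rightarrow> 'u) \<Rightarrow> 'z \<Rightarrow> 'm" where
  "bc_fm fm = (\<lambda>a b. fm (restr R \<rho> a) (restr R \<rho> b))"

lemma obj_stack_base_change:
  "(x, a) \<in> obj (stack_base_change R R' \<rho> X) \<longleftrightarrow> x \<in> obj X \<and> a \<in> algs R' \<and> bas X x = restr R \<rho> a"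
  by (simp add: stack_base_change_def)

lemma arr_stack_base_change:
  "f \<in> arr (stack_base_change R R' \<rho> X) (x, a) (y, b) \<longleftrightarrow> f \<in> arr X x y \<and> ovr X f \<in> alg_hom R' b a"
  by (simp add: stack_base_change_def)

lemma bas_stack_base_change: "bas (stack_base_change R R' \<rho> X) = snd"
  and ovr_stack_base_change: "ovr (stack_base_change R R' \<rho> X) = ovr X"
  by (simp_all add: stack_base_change_def)

lemma stack_hom_base_change:
  assumes "stack_hom R Z X fo fm"
  shows "stack_hom R' (psh_base_change R \<rho> Z) (stack_base_change R R' \<rho> X) (bc_fo fo) (bc_fm fm)"
proof -
  note hom = assms[unfolded stack_hom_def]
  note objs = hom[THEN conjunct1, rule_format]
    and arrs = hom[THEN conjunct2, THEN conjunct1, rule_format]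
    and ids = hom[THEN conjunct2, THEN conjunct2, THEN conjunct1, rule_format]
    and comps = hom[THEN conjunct2, THEN conjunct2, THEN conjunct2, rule_format]
  show ?thesis
    unfolding stack_hom_def psh_base_change_def stack_base_change_def bc_fo_def bc_fm_def
      psh.simps fibcat.simps prod.case mem_Collect_eq snd_conv
  proof (intro conjI ballI)
    fix a b h z
    assume ab: "a \<in> algs R'" "b \<in> algs R'" and h: "h \<in> alg_hom R' a b" and z: "z \<in> sec Z (restr R \<rho> a)"
    note arr = arrs[OF restr_algs[OF ab(1)] restr_algs[OF ab(2)] restr_alg_hom[OF h] z]
    show "fm (restr R \<rho> a) (restr R \<rho> b) h z \<in>
        arr X (fo (restr R \<rho> b) (res Z (restr R \<rho> a) (restr R \<rho> b) h z)) (fo (restr R \<rho> a) z)"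
      "ovr X (fm (restr R \<rho> a) (restr R \<rho> b) h z) = h"
      using arr by simp_all
    \<comment> \<open>The condition on arrows that \<open>X\<close> does not impose: they must lie
      over an \<open>R'\<close>-linear map, and \<open>h\<close> is one.\<close>
    then show "ovr X (fm (restr R \<rho> a) (restr R \<rho> b) h z) \<in> alg_hom R' a b"
      using h by simp
  next
    fix a b c h k z
    assume abc: "a \<in> algs R'" "b \<in> algs R'" "c \<in> algs R'" and h: "h \<in> alg_hom R' a b"
      and k: "k \<in> alg_hom R' b c" and z: "z \<in> sec Z (restr R \<rho> a)"
    show "fm (restr R \<rho> a) (restr R \<rho> c) (compose (carrier (fst a)) k h) z =
        cmp X (fm (restr R \<rho> a) (restr R \<rho> b) h z)
          (fm (restr R \<rho> b) (restr R \<rho> c) k (res Z (restr R \<rho> a) (restr R \<rho> b) h z))"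
      using comps[OF restr_algs[OF abc(1)] restr_algs[OF abc(2)] restr_algs[OF abc(3)]
          restr_alg_hom[OF h] restr_alg_hom[OF k] z] by simp
  next
    show "fm (restr R \<rho> a) (restr R \<rho> a) (id_hom (fst a)) z = idm X (fo (restr R \<rho> a) z)"
      if "a \<in> algs R'" "z \<in> sec Z (restr R \<rho> a)" for a z
      using ids[OF restr_algs[OF that(1)] that(2)] by simp
  qed (simp_all add: objs restr_algs)
qed

text \<open>The fibre over \<open>(x, a)\<close> is the same functor as the fibre over \<open>x\<close>, so that smoothness and
  surjectivity are inherited.\<close>

lemma stack_fibre_base_change:
  assumes "bas X x = restr R \<rho> a"
  shows "stack_fibre R' (psh_base_change R \<rho> Z) (stack_base_change R R' \<rho> X) (bc_fo fo) (bc_fm fm) (x, a) =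
    stack_fibre R Z X fo fm x"
proof -
  \<comment> \<open>The additional \<open>R'\<close>-linearity required of arrows in the base change
    is automatic for structure maps of algebras over \<open>fst a\<close>. Since
    \<open>stack_fibre\<close> has no sections outside such algebras, the two functors are equal as
    records.\<close>
  have "snd c \<in> alg_hom R' a (restr R' (snd a) c)" if "c \<in> algs (fst a)" for c
    using algsD[OF that] by (simp add: alg_hom_def restr_def)
  then show ?thesis
    using assms
    by (auto simp: stack_fibre_def psh_base_change_def stack_base_change_def bc_fo_def bc_fm_def
        Let_def restr_restr_alg intro!: ext)
qed

lemma smooth_cover_base_change:
  assumes "smooth_cover R Z X fo fm"
  shows "smooth_cover R' (psh_base_change R \<rho> Z) (stack_base_change R R' \<rho> X) (bc_fo fo) (bc_fm fm)"
proof -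
  let ?fib = "stack_fibre R' (psh_base_change R \<rho> Z) (stack_base_change R R' \<rho> X) (bc_fo fo) (bc_fm fm)"
  have hom: "stack_hom R Z X fo fm" and fib: "\<And>x. x \<in> obj X \<Longrightarrow>
      smooth_algebraic_space (fst (bas X x)) (stack_fibre R Z X fo fm x) \<and>
      surjective_on_base (fst (bas X x)) (stack_fibre R Z X fo fm x)"
    using assms by (simp_all add: smooth_cover_def)
  have "smooth_algebraic_space (fst a) (?fib (x, a)) \<and> surjective_on_base (fst a) (?fib (x, a))"
    if "x \<in> obj X" "bas X x = restr R \<rho> a" for x a
    using fib[OF that(1)] unfolding stack_fibre_base_change[of X x a, OF that(2)] that(2) by simp
  then have "smooth_algebraic_space (fst (snd w)) (?fib w) \<and> surjective_on_base (fst (snd w)) (?fib w)"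
    if "w \<in> obj (stack_base_change R R' \<rho> X)" for w
    using that by (metis prod.collapse obj_stack_base_change)
  then show ?thesis
    using stack_hom_base_change[OF hom] by (simp add: smooth_cover_def bas_stack_base_change)
qed

text \<open>The arrow \<open>f\<close> makes \<open>x'\<close> a pullback of \<open>x\<close>. An
  arrow over \<open>\<rho>\<close> into an object isomorphic to \<open>x\<close> can be continued to
  \<open>x\<close> and then factors through the cartesian arrow \<open>f\<close> over the identity
  of \<open>R'\<close>; conversely, an isomorphism into \<open>x'\<close> is composed with
  \<open>f\<close>.\<close>

lemma stack_point_map_iso_class:
  assumes X: "fibred_in_groupoids R X" and x: "x \<in> obj X" "bas X x = self_alg R"
    and x': "x' \<in> obj X" "bas X x' = (R', \<rho>)" and f: "f \<in> arr X x' x" "ovr X f = \<rho>"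
  shows "stack_point_map R' \<rho> X (iso_class X x) =
    iso_class (stack_base_change R R' \<rho> X) (x', self_alg R')"
proof -
  interpret fibred_in_groupoids R X by (fact X)
  \<comment> \<open>Needed twice: as an \<open>R\<close>-algebra map for cartesian lifting in
    \<open>X\<close>, and as an \<open>R'\<close>-algebra map for isomorphisms in the base
    change.\<close>
  have id: "id_hom R' \<in> alg_hom R (R', \<rho>) (R', \<rho>)" "id_hom R' \<in> alg_hom R' (self_alg R') (self_alg R')"
    using restr_alg_hom[of "id_hom R'" "self_alg R'" "self_alg R'"] ring_R'
    by (simp_all add: restr_self_alg)
      (simp_all add: alg_hom_def self_alg_def id_hom_ring_hom id_hom_extensional compose_id_hom_right)
  have c1: "compose (carrier R) (id_hom R') \<rho> = \<rho>" and c2: "compose (carrier R) \<rho> (id_hom R) = \<rho>"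
    by (auto intro!: compose_id_hom_left compose_id_hom_right \<rho>_ext \<rho>_closed)
  have "(\<exists>y\<in>iso_class X x. \<exists>g\<in>arr X w y. ovr X g = \<rho>) \<longleftrightarrow> (\<exists>k\<in>arr X w x'. ovr X k = id_hom R')"
    if w: "w \<in> obj X" "bas X w = (R', \<rho>)" for w
  proof
    assume "\<exists>y\<in>iso_class X x. \<exists>g\<in>arr X w y. ovr X g = \<rho>"
    then obtain y g j where y: "y \<in> obj X" "bas X y = self_alg R" and g: "g \<in> arr X w y" "ovr X g = \<rho>"
      and j: "j \<in> arr X y x" "ovr X j = id_hom R"
      using x by (auto simp: iso_class_def id_over_def self_alg_def)
    have "cmp X j g \<in> arr X w x" "ovr X (cmp X j g) = \<rho>"
      using cmp_arr[OF w(1) y(1) x(1) g(1) j(1)] ovr_cmp[OF w(1) y(1) x(1) g(1) j(1)] x g j c2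
      by (simp_all add: self_alg_def)
    then show "\<exists>k\<in>arr X w x'. ovr X k = id_hom R'"
      using cartesian[OF x(1) x'(1) w(1) f(1), of "cmp X j g" "id_hom R'"] w x' x id c1 f
      by (auto simp: self_alg_def)
  next
    assume "\<exists>k\<in>arr X w x'. ovr X k = id_hom R'"
    then obtain k where k: "k \<in> arr X w x'" "ovr X k = id_hom R'" by blast
    have "cmp X f k \<in> arr X w x" "ovr X (cmp X f k) = \<rho>"
      using cmp_arr[OF w(1) x'(1) x(1) k(1) f(1)] ovr_cmp[OF w(1) x'(1) x(1) k(1) f(1)] x f k c1
      by (simp_all add: self_alg_def)
    moreover have "x \<in> iso_class X x"
      using x idm_arr ovr_idm by (auto simp: iso_class_def)
    ultimately show "\<exists>y\<in>iso_class X x. \<exists>g\<in>arr X w y. ovr X g = \<rho>" by blast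
  qed
  note pullback_iff = this
  have "(w, a) \<in> stack_point_map R' \<rho> X (iso_class X x) \<longleftrightarrow>
      (w, a) \<in> iso_class (stack_base_change R R' \<rho> X) (x', self_alg R')" for w a
  proof (cases "w \<in> obj X \<and> bas X w = (R', \<rho>) \<and> a = self_alg R'")
    case True
    have "(w, a) \<in> stack_point_map R' \<rho> X (iso_class X x) \<longleftrightarrow>
        (\<exists>y\<in>iso_class X x. \<exists>g\<in>arr X w y. ovr X g = \<rho>)"
      using True by (simp add: stack_point_map_def)
    also have "\<dots> \<longleftrightarrow> (\<exists>k\<in>arr X w x'. ovr X k = id_hom R')"
      using True by (intro pullback_iff) auto
    also have "\<dots> \<longleftrightarrow> (w, a) \<in> iso_class (stack_base_change R R' \<rho> X) (x', self_alg R')"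
      using True id(2) self_alg_algs[OF cring_R']
      by (auto simp: iso_class_def id_over_def obj_stack_base_change arr_stack_base_change
          bas_stack_base_change ovr_stack_base_change restr_self_alg fst_self_alg)
    finally show ?thesis .
  next
    case False
    then show ?thesis
      by (auto simp: stack_point_map_def iso_class_def obj_stack_base_change bas_stack_base_change
          restr_self_alg)
  qed
  from this[of "fst w" "snd w" for w] show ?thesis
    by (intro Set.set_eqI) simp
qed

lemma stack_point_map_closed:
  assumes "fibred_in_groupoids R X" and "P \<in> stack_points R X"
  shows "stack_point_map R' \<rho> X P \<in> stack_points R' (stack_base_change R R' \<rho> X)"
proof -
  interpret fibred_in_groupoids R X by fact
  obtain x where x: "x \<in> obj X" "bas X x = self_alg R" "P = iso_class X x"
    using assms(2) by (auto simp: stack_points_def)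
  obtain x' f where x': "x' \<in> obj X" "bas X x' = (R', \<rho>)" and f: "f \<in> arr X x' x" "ovr X f = \<rho>"
    using pullback[OF x(1) R'_algs, of \<rho>] \<rho>_alg_hom unfolding x(2) by blast
  have "(x', self_alg R') \<in>
      {w \<in> obj (stack_base_change R R' \<rho> X). bas (stack_base_change R R' \<rho> X) w = self_alg R'}"
    using x' self_alg_algs[OF cring_R']
    by (simp add: obj_stack_base_change bas_stack_base_change restr_self_alg)
  then show ?thesis
    using stack_point_map_iso_class[OF assms(1) x(1,2) x' f] x(3) unfolding stack_points_def by blast
qed

end


section \<open>The topology on the points of a stack\<close>

text \<open>Preimages commute with intersections and unions. Without this fact
  \<open>topology\<close> says nothing about the open sets of \<open>stack_topology\<close>.\<close>

lemma istopology_stack_open: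
  fixes R :: "'u ring"
  shows "istopology (stack_open R \<tau> X)"
  unfolding istopology_def
proof (intro conjI allI impI)
  fix V W assume VW: "stack_open R \<tau> X V" "stack_open R \<tau> X W"
  have eq: "{z \<in> sec Z (self_alg R). iso_class X (fo (self_alg R) z) \<in> V \<inter> W} =
      {z \<in> sec Z (self_alg R). iso_class X (fo (self_alg R) z) \<in> V} \<inter>
      {z \<in> sec Z (self_alg R). iso_class X (fo (self_alg R) z) \<in> W}" for Z :: "('u, 'u) psh" and fo
    by blast
  show "stack_open R \<tau> X (V \<inter> W)"
    using VW unfolding stack_open_def eq by blast
next
  fix \<W> assume \<W>: "\<forall>W\<in>\<W>. stack_open R \<tau> X W"
  have eq: "{z \<in> sec Z (self_alg R). iso_class X (fo (self_alg R) z) \<in> \<Union>\<W>} =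
      (\<Union>W\<in>\<W>. {z \<in> sec Z (self_alg R). iso_class X (fo (self_alg R) z) \<in> W})" for Z :: "('u, 'u) psh" and fo
    by blast
  show "stack_open R \<tau> X (\<Union>\<W>)"
    using \<W> unfolding stack_open_def eq by blast
qed

lemma openin_stack_topology: "openin (stack_topology R \<tau> X) W \<longleftrightarrow> stack_open R \<tau> X W"
  by (simp add: stack_topology_def istopology_stack_open topology_inverse')

text \<open>The set of all points is itself open: its preimage in a cover \<open>Z\<close> is all of
  \<open>Z(R)\<close>, which is the space of \<open>\<tau> Z\<close>.\<close>

lemma topspace_stack_topology:
  assumes R: "cring R" and \<tau>: "good_topologization R T \<tau>"
  shows "topspace (stack_topology R \<tau> X) = stack_points R X"
proof -
  have "openin (\<tau> Z) {z \<in> sec Z (self_alg R). iso_class X (fo (self_alg R) z) \<in> stack_points R X}"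
    if "finite_type_scheme R Z" "smooth_cover R Z X fo fm" for Z fo fm
  proof -
    have "iso_class X (fo (self_alg R) z) \<in> stack_points R X" if "z \<in> sec Z (self_alg R)" for z
      using \<open>smooth_cover R Z X fo fm\<close> that self_alg_algs[OF R]
      by (simp add: smooth_cover_def stack_hom_def stack_points_def)
    moreover have "topspace (\<tau> Z) = sec Z (self_alg R)"
      using \<tau> that(1) by (simp add: good_topologization_def)
    ultimately have "{z \<in> sec Z (self_alg R). iso_class X (fo (self_alg R) z) \<in> stack_points R X} =
        topspace (\<tau> Z)"
      by blast
    then show ?thesis by simp
  qed
  then have "stack_open R \<tau> X (stack_points R X)"
    unfolding stack_open_def by blast
  then show ?thesis
    unfolding topspace_def openin_stack_topology by (auto simp: stack_open_def)
qed

theorem proposition9p0p4: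
  fixes R R' :: "'u ring" and T T' :: "'u topology"
    and \<tau> \<tau>' :: "('u, 'u) psh \<Rightarrow> 'u topology"
    and \<rho> :: "'u \<Rightarrow> 'u"
    and X :: "('u, 'o, 'm) fibcat"
  assumes "infinite (UNIV :: 'u set)"
    and "topological_ring R T" and "topological_ring R' T'"
    and "sufficiently_disconnected R" and "sufficiently_disconnected R'"
    and "good_topologization R T \<tau>" and "good_topologization R' T' \<tau>'"
    and "smooth_quotient_property R \<tau>" and "smooth_quotient_property R' \<tau>'"
    and "\<rho> \<in> ring_hom R R'" and "\<rho> \<in> extensional (carrier R)" and "continuous_map T T' \<rho>"
    and "\<And>F :: ('u, 'u) psh. finite_type_scheme R F \<Longrightarrow>
      continuous_map (\<tau> F) (\<tau>' (psh_base_change R \<rho> F)) (res F (self_alg R) (R', \<rho>) \<rho>)"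
    and "algebraic_stack R X"
  shows "continuous_map (stack_topology R \<tau> X)
    (stack_topology R' \<tau>' (stack_base_change R R' \<rho> X)) (stack_point_map R' \<rho> X)"
proof -
  let ?X' = "stack_base_change R R' \<rho> X" and ?m = "stack_point_map R' \<rho> X"
  interpret base_change R R' \<rho>
    using assms by (intro base_change.intro) (simp_all add: topological_ring_def)
  have X: "fibred_in_groupoids R X"
    using assms(14) by (simp add: algebraic_stack_def stack_def)
  note top = topspace_stack_topology[OF cring_R assms(6)] topspace_stack_topology[OF cring_R' assms(7)]
  have "stack_open R \<tau> X {P \<in> stack_points R X. ?m P \<in> W}" if W: "stack_open R' \<tau>' ?X' W" for W
    unfolding stack_open_def
  proof (intro conjI allI impI)
    fix Z :: "('u, 'u) psh" and fo fm assume Z: "finite_type_scheme R Z \<and> smooth_cover R Z X fo fm"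
    let ?Z' = "psh_base_change R \<rho> Z" and ?r = "res Z (self_alg R) (R', \<rho>) \<rho>"
    let ?V = "{z \<in> sec ?Z' (self_alg R'). iso_class ?X' (bc_fo fo (self_alg R') z) \<in> W}"
    have "openin (\<tau>' ?Z') ?V"
      using W Z finite_type_scheme_base_change[OF assms(1)] smooth_cover_base_change
      unfolding stack_open_def by blast
    then have "openin (\<tau> Z) {z \<in> topspace (\<tau> Z). ?r z \<in> ?V}"
      using assms(13) Z openin_continuous_map_preimage by blast
    moreover have "topspace (\<tau> Z) = sec Z (self_alg R)"
      using assms(6) Z by (simp add: good_topologization_def)
    \<comment> \<open>Commutativity of the square with corners \<open>Z(R)\<close>,
      \<open>Z(R')\<close> and the two sets of stack points. The arrow that \<open>fm\<close>
      assigns to \<open>\<rho>\<close> and \<open>z\<close> exhibits the object of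
      \<open>?r z\<close> as a pullback of the object of \<open>z\<close>, so the description of the
      natural map on classes applies.\<close>
    moreover have "iso_class X (fo (self_alg R) z) \<in> {P \<in> stack_points R X. ?m P \<in> W} \<longleftrightarrow> ?r z \<in> ?V"
      if z: "z \<in> sec Z (self_alg R)" for z
    proof -
      have hom: "stack_hom R Z X fo fm" using Z by (simp add: smooth_cover_def)
      have "presheaf R Z" using Z by (simp add: finite_type_scheme_def sheaf_def)
      then have rz: "?r z \<in> sec Z (R', \<rho>)"
        using presheaf_res_closed[OF _ self_alg_algs[OF cring_R] R'_algs \<rho>_alg_hom z] by simp
      have x: "fo (self_alg R) z \<in> obj X" "bas X (fo (self_alg R) z) = self_alg R"
        and x': "fo (R', \<rho>) (?r z) \<in> obj X" "bas X (fo (R', \<rho>) (?r z)) = (R', \<rho>)"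
        and f: "fm (self_alg R) (R', \<rho>) \<rho> z \<in> arr X (fo (R', \<rho>) (?r z)) (fo (self_alg R) z)"
          "ovr X (fm (self_alg R) (R', \<rho>) \<rho> z) = \<rho>"
        using hom z rz self_alg_algs[OF cring_R] R'_algs \<rho>_alg_hom unfolding stack_hom_def by blast+
      show ?thesis
        using stack_point_map_iso_class[OF X x x' f] x rz
        by (auto simp: stack_points_def bc_fo_def restr_self_alg psh_base_change_def)
    qed
    ultimately show "openin (\<tau> Z)
        {z \<in> sec Z (self_alg R). iso_class X (fo (self_alg R) z) \<in> {P \<in> stack_points R X. ?m P \<in> W}}"
      by (smt (verit, ccfv_threshold) Collect_cong)
  qed blast
  then show ?thesis
    using stack_point_map_closed[OF X] by (auto simp: continuous_map_def top openin_stack_topology)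
qed

end
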